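(* Let $K$ be an algebraically closed field of characteristic zero, let $X$ be an irreducible affine scheme of finite type over $K$, let $G$ be a reductive group acting on $X$, and let $\pi:X\to X/\!\!/G$ be the natural map. Let $U$ be an open subscheme of $X/\!\!/G$. If $U$ is normal, its complement $Z$ has codimension at least two in $X/\!\!/G$, $\pi^{-1}(Z)$ has codimension at least two in $X$, and $X$ has property $(S_2)$, then $X/\!\!/G$ is normal.
   Context: $X/\!\!/G=\mathrm{Spec}\,K[X]^G$. A scheme $X$ has property $(S_i)$ if $\mathrm{depth}(\mathcal{O}_{X,Z})\ge\min(i,\mathrm{codim}_XZ)$ for every irreducible closed subset $Z$ of $X$, where $\mathcal{O}_{X,Z}$ is the local ring of $X$ at the generic point of $Z$. The empty set is regarded as having infinite codimension. *)

theory Defs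
  imports "HOL-Algebra.Algebra" "HOL-Analysis.Abstract_Topology" "HOL-Library.Extended_Nat"
begin

section \<open>Irreducible closed sets and codimension in a topological space\<close>

definition irreducible_in :: "'x topology \<Rightarrow> 'x set \<Rightarrow> bool" where
  "irreducible_in T S \<longleftrightarrow> S \<subseteq> topspace T \<and> S \<noteq> {} \<and>
     (\<forall>C D. closedin T C \<and> closedin T D \<and> S \<subseteq> C \<union> D \<longrightarrow> S \<subseteq> C \<or> S \<subseteq> D)"

definition irreducible_closed :: "'x topology \<Rightarrow> 'x set \<Rightarrow> bool" where
  "irreducible_closed T Z \<longleftrightarrow> closedin T Z \<and> irreducible_in T Z"

definition codim_irreducible :: "'x topology \<Rightarrow> 'x set \<Rightarrow> enat" where
  "codim_irreducible T Z =
     Sup {enat n | n. \<exists>c :: nat \<Rightarrow> 'x set. c 0 = Z \<and>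
       (\<forall>i\<le>n. irreducible_closed T (c i)) \<and> (\<forall>i<n. c i \<subset> c (Suc i))}"

text \<open>The infimum over the empty set is \<open>\<infinity>\<close>, so the empty set has infinite codimension.\<close>

definition codim :: "'x topology \<Rightarrow> 'x set \<Rightarrow> enat" where
  "codim T Z = Inf {codim_irreducible T Y | Y. irreducible_closed T Y \<and> Y \<subseteq> Z}"

section \<open>Affine schemes\<close>

definition Spec :: "('a, 'm) ring_scheme \<Rightarrow> 'a set set" where
  "Spec R = {P. primeideal P R}"

definition zariski :: "('a, 'm) ring_scheme \<Rightarrow> 'a set topology" where
  "zariski R = topology_generated_by {{P \<in> Spec R. f \<notin> P} | f. f \<in> carrier R}"

definition generic_point :: "('a, 'm) ring_scheme \<Rightarrow> 'a set set \<Rightarrow> 'a set" where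
  "generic_point R Z = (THE P. P \<in> Spec R \<and> zariski R closure_of {P} = Z)"

text \<open>For a prime ideal \<open>P\<close>, the localization of \<open>R\<close> at \<open>P\<close> is the ring of fractions with
  denominators in \<open>carrier R - P\<close>; a fraction is a class of pairs (numerator, denominator).\<close>

definition frac_rel ::
    "('a, 'm) ring_scheme \<Rightarrow> 'a set \<Rightarrow> (('a \<times> 'a) \<times> ('a \<times> 'a)) set" where
  "frac_rel R P = {((a, s), (b, t)) | a s b t.
     a \<in> carrier R \<and> s \<in> carrier R - P \<and> b \<in> carrier R \<and> t \<in> carrier R - P \<and>
     (\<exists>u \<in> carrier R - P. u \<otimes>\<^bsub>R\<^esub> (t \<otimes>\<^bsub>R\<^esub> a \<ominus>\<^bsub>R\<^esub> s \<otimes>\<^bsub>R\<^esub> b) = \<zero>\<^bsub>R\<^esub>)}"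

definition frac :: "('a, 'm) ring_scheme \<Rightarrow> 'a set \<Rightarrow> 'a \<Rightarrow> 'a \<Rightarrow> ('a \<times> 'a) set" where
  "frac R P a s = frac_rel R P `` {(a, s)}"

definition localization :: "('a, 'm) ring_scheme \<Rightarrow> 'a set \<Rightarrow> ('a \<times> 'a) set ring" where
  "localization R P =
    \<lparr> carrier = (carrier R \<times> (carrier R - P)) // frac_rel R P,
      monoid.mult = (\<lambda>p q. \<Union>(a, s) \<in> p. \<Union>(b, t) \<in> q. frac R P (a \<otimes>\<^bsub>R\<^esub> b) (s \<otimes>\<^bsub>R\<^esub> t)),
      one = frac R P \<one>\<^bsub>R\<^esub> \<one>\<^bsub>R\<^esub>,
      ring.zero = frac R P \<zero>\<^bsub>R\<^esub> \<one>\<^bsub>R\<^esub>,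
      ring.add = (\<lambda>p q. \<Union>(a, s) \<in> p. \<Union>(b, t) \<in> q.
               frac R P (t \<otimes>\<^bsub>R\<^esub> a \<oplus>\<^bsub>R\<^esub> s \<otimes>\<^bsub>R\<^esub> b) (s \<otimes>\<^bsub>R\<^esub> t)) \<rparr>"

section \<open>Depth and Serre's condition\<close>

text \<open>The first condition says that \<open>xs ! i\<close> is not a zero divisor modulo its predecessors.\<close>

definition regular_sequence :: "('a, 'm) ring_scheme \<Rightarrow> 'a list \<Rightarrow> bool" where
  "regular_sequence R xs \<longleftrightarrow> set xs \<subseteq> carrier R \<and>
     (\<forall>i < length xs. \<forall>a \<in> carrier R.
        xs ! i \<otimes>\<^bsub>R\<^esub> a \<in> genideal R (set (take i xs)) \<longrightarrow> a \<in> genideal R (set (take i xs))) \<and>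
     genideal R (set xs) \<noteq> carrier R"

text \<open>Intended for Noetherian local rings, where the maximal ideal is unique.\<close>

definition depth :: "('a, 'm) ring_scheme \<Rightarrow> enat" where
  "depth R = Sup {enat (length xs) | xs.
     regular_sequence R xs \<and> set xs \<subseteq> (THE M. maximalideal M R)}"

definition serre_S :: "nat \<Rightarrow> ('a, 'm) ring_scheme \<Rightarrow> bool" where
  "serre_S i R \<longleftrightarrow> (\<forall>Z. irreducible_closed (zariski R) Z \<longrightarrow>
     min (enat i) (codim (zariski R) Z) \<le> depth (localization R (generic_point R Z)))"

section \<open>Normality\<close>

definition integral_over :: "('a, 'm) ring_scheme \<Rightarrow> 'a set \<Rightarrow> 'a \<Rightarrow> bool" where
  "integral_over F S x \<longleftrightarrow> (\<exists>(n :: nat) c. (\<forall>i<n. c i \<in> S) \<and>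
     x [^]\<^bsub>F\<^esub> n \<oplus>\<^bsub>F\<^esub> (\<Oplus>\<^bsub>F\<^esub>i\<in>{..<n}. c i \<otimes>\<^bsub>F\<^esub> x [^]\<^bsub>F\<^esub> i) = \<zero>\<^bsub>F\<^esub>)"

definition fraction_field :: "('a, 'm) ring_scheme \<Rightarrow> ('a \<times> 'a) set ring" where
  "fraction_field R = localization R {\<zero>\<^bsub>R\<^esub>}"

definition to_fraction_field :: "('a, 'm) ring_scheme \<Rightarrow> 'a \<Rightarrow> ('a \<times> 'a) set" where
  "to_fraction_field R r = frac R {\<zero>\<^bsub>R\<^esub>} r \<one>\<^bsub>R\<^esub>"

definition normal_domain :: "('a, 'm) ring_scheme \<Rightarrow> bool" where
  "normal_domain R \<longleftrightarrow> domain R \<and>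
     (\<forall>x \<in> carrier (fraction_field R).
        integral_over (fraction_field R) (to_fraction_field R ` carrier R) x \<longrightarrow>
        x \<in> to_fraction_field R ` carrier R)"

text \<open>Normality of the open subscheme of the affine scheme of \<open>R\<close> with underlying set \<open>U\<close>; its
  local rings are those of the ambient scheme. The whole scheme is the case \<open>U = Spec R\<close>.\<close>

definition normal_on :: "('a, 'm) ring_scheme \<Rightarrow> 'a set set \<Rightarrow> bool" where
  "normal_on R U \<longleftrightarrow> (\<forall>P \<in> U. normal_domain (localization R P))"

section \<open>Algebras over a field\<close>

definition char_zero :: "('k, 'm) ring_scheme \<Rightarrow> bool" where
  "char_zero K \<longleftrightarrow> (\<forall>n :: nat. n > 0 \<longrightarrow> [n] \<cdot>\<^bsub>K\<^esub> \<one>\<^bsub>K\<^esub> \<noteq> \<zero>\<^bsub>K\<^esub>)"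

definition finite_type_algebra ::
    "('k, 'm) ring_scheme \<Rightarrow> ('k, 'a, 'n) module_scheme \<Rightarrow> bool" where
  "finite_type_algebra K A \<longleftrightarrow> algebra K A \<and>
     (\<exists>S. finite S \<and> S \<subseteq> carrier A \<and>
        generate_ring A ((\<lambda>k. k \<odot>\<^bsub>A\<^esub> \<one>\<^bsub>A\<^esub>) ` carrier K \<union> S) = carrier A)"

definition algebra_hom ::
    "('k, 'm) ring_scheme \<Rightarrow> ('k, 'a, 'n) module_scheme \<Rightarrow> ('k, 'b, 'p) module_scheme
      \<Rightarrow> ('a \<Rightarrow> 'b) set" where
  "algebra_hom K A B = {f \<in> ring_hom A B.
     \<forall>k \<in> carrier K. \<forall>a \<in> carrier A. f (k \<odot>\<^bsub>A\<^esub> a) = k \<odot>\<^bsub>B\<^esub> f a}"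

definition self_algebra :: "('k, 'm) ring_scheme \<Rightarrow> ('k, 'k) module" where
  "self_algebra K = \<lparr> carrier = carrier K, monoid.mult = monoid.mult K, one = \<one>\<^bsub>K\<^esub>,
     ring.zero = \<zero>\<^bsub>K\<^esub>, ring.add = ring.add K, smult = monoid.mult K \<rparr>"

section \<open>Affine algebraic groups\<close>

definition function_algebra ::
    "('k, 'm) ring_scheme \<Rightarrow> ('g, 'n) monoid_scheme \<Rightarrow> ('g \<Rightarrow> 'k) set
      \<Rightarrow> ('k, 'g \<Rightarrow> 'k) module" where
  "function_algebra K G F =
    \<lparr> carrier = F,
      monoid.mult = (\<lambda>f h. \<lambda>x\<in>carrier G. f x \<otimes>\<^bsub>K\<^esub> h x),
      one = (\<lambda>x\<in>carrier G. \<one>\<^bsub>K\<^esub>),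
      ring.zero = (\<lambda>x\<in>carrier G. \<zero>\<^bsub>K\<^esub>),
      ring.add = (\<lambda>f h. \<lambda>x\<in>carrier G. f x \<oplus>\<^bsub>K\<^esub> h x),
      smult = (\<lambda>k f. \<lambda>x\<in>carrier G. k \<otimes>\<^bsub>K\<^esub> f x) \<rparr>"

text \<open>An affine algebraic group over an algebraically closed field \<open>K\<close> of characteristic zero
  (hence reduced, by Cartier's theorem) is encoded as its group \<open>G\<close> of \<open>K\<close>-points with its
  coordinate algebra \<open>KG\<close> of regular functions: a finite type \<open>K\<close>-algebra of functions whose
  algebra homomorphisms to \<open>K\<close> are exactly the evaluations at the points (Nullstellensatz), such
  that multiplication and inversion are morphisms. The comorphism of multiplication takes
  values in \<open>KG \<otimes> KG\<close>, i.e. \<open>f (g h)\<close> is a finite sum of products \<open>a\<^sub>i (g) b\<^sub>i (h)\<close>.\<close>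

definition affine_algebraic_group ::
    "('k, 'm) ring_scheme \<Rightarrow> ('g, 'n) monoid_scheme \<Rightarrow> ('g \<Rightarrow> 'k) set \<Rightarrow> bool" where
  "affine_algebraic_group K G KG \<longleftrightarrow>
     group G \<and> KG \<subseteq> (carrier G \<rightarrow>\<^sub>E carrier K) \<and>
     finite_type_algebra K (function_algebra K G KG) \<and>
     (\<forall>\<chi> \<in> algebra_hom K (function_algebra K G KG) (self_algebra K).
        \<exists>!g. g \<in> carrier G \<and> (\<forall>f \<in> KG. \<chi> f = f g)) \<and>
     (\<forall>f \<in> KG. \<exists>(n :: nat) a b. (\<forall>i<n. a i \<in> KG \<and> b i \<in> KG) \<and>
        (\<forall>g \<in> carrier G. \<forall>h \<in> carrier G.
           f (g \<otimes>\<^bsub>G\<^esub> h) = (\<Oplus>\<^bsub>K\<^esub>i\<in>{..<n}. a i g \<otimes>\<^bsub>K\<^esub> b i h))) \<and>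
     (\<forall>f \<in> KG. (\<lambda>g\<in>carrier G. f (inv\<^bsub>G\<^esub> g)) \<in> KG)"

definition group_zariski ::
    "('k, 'm) ring_scheme \<Rightarrow> ('g, 'n) monoid_scheme \<Rightarrow> ('g \<Rightarrow> 'k) set \<Rightarrow> 'g topology" where
  "group_zariski K G KG =
     topology_generated_by {{g \<in> carrier G. f g \<noteq> \<zero>\<^bsub>K\<^esub>} | f. f \<in> KG}"

text \<open>An element is unipotent if right translation by it acts on the coordinate algebra as a
  locally unipotent operator.\<close>

definition unipotent_element ::
    "('k, 'm) ring_scheme \<Rightarrow> ('g, 'n) monoid_scheme \<Rightarrow> ('g \<Rightarrow> 'k) set \<Rightarrow> 'g \<Rightarrow> bool" where
  "unipotent_element K G KG g \<longleftrightarrow> g \<in> carrier G \<and>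
     (\<forall>f \<in> KG. \<exists>n. ((\<lambda>h. \<lambda>x\<in>carrier G. h (x \<otimes>\<^bsub>G\<^esub> g) \<ominus>\<^bsub>K\<^esub> h x) ^^ n) f
        = (\<lambda>x\<in>carrier G. \<zero>\<^bsub>K\<^esub>))"

text \<open>The unipotent radical, i.e. the largest closed connected normal unipotent subgroup, is
  trivial. The group itself need not be connected.\<close>

definition reductive_group ::
    "('k, 'm) ring_scheme \<Rightarrow> ('g, 'n) monoid_scheme \<Rightarrow> ('g \<Rightarrow> 'k) set \<Rightarrow> bool" where
  "reductive_group K G KG \<longleftrightarrow> affine_algebraic_group K G KG \<and>
     (\<forall>N. N \<lhd> G \<and> closedin (group_zariski K G KG) N \<and>
        connectedin (group_zariski K G KG) N \<and> (\<forall>g \<in> N. unipotent_element K G KG g)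
        \<longrightarrow> N = {\<one>\<^bsub>G\<^esub>})"

section \<open>Actions on affine schemes and their quotients\<close>

text \<open>An action \<open>G \<times> X \<rightarrow> X\<close> on the spectrum of \<open>A\<close>, given by the induced left action
  \<open>(g f) (x) = f (g\<^sup>-\<^sup>1 x)\<close> on \<open>A\<close> by \<open>K\<close>-algebra automorphisms. The last condition says that
  the action is a morphism: its comorphism has values in \<open>KG \<otimes> A\<close>.\<close>

definition algebraic_action ::
    "('k, 'm) ring_scheme \<Rightarrow> ('g, 'n) monoid_scheme \<Rightarrow> ('g \<Rightarrow> 'k) set
      \<Rightarrow> ('k, 'a, 'p) module_scheme \<Rightarrow> ('g \<Rightarrow> 'a \<Rightarrow> 'a) \<Rightarrow> bool" where
  "algebraic_action K G KG A \<sigma> \<longleftrightarrow>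
     group_action G (carrier A) \<sigma> \<and> (\<forall>g \<in> carrier G. \<sigma> g \<in> algebra_hom K A A) \<and>
     (\<forall>f \<in> carrier A. \<exists>(n :: nat) \<phi> b. (\<forall>i<n. \<phi> i \<in> KG \<and> b i \<in> carrier A) \<and>
        (\<forall>g \<in> carrier G. \<sigma> g f = (\<Oplus>\<^bsub>A\<^esub>i\<in>{..<n}. \<phi> i g \<odot>\<^bsub>A\<^esub> b i)))"

definition invariant_ring ::
    "('g, 'n) monoid_scheme \<Rightarrow> ('k, 'a, 'p) module_scheme \<Rightarrow> ('g \<Rightarrow> 'a \<Rightarrow> 'a)
      \<Rightarrow> ('k, 'a, 'p) module_scheme" where
  "invariant_ring G A \<sigma> =
     A \<lparr> carrier := {f \<in> carrier A. \<forall>g \<in> carrier G. \<sigma> g f = f} \<rparr>"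

text \<open>The map \<open>\<pi>\<close> from the spectrum of \<open>A\<close> to that of the invariant ring, induced by the
  inclusion of rings.\<close>

definition invariant_quotient_map ::
    "('g, 'n) monoid_scheme \<Rightarrow> ('k, 'a, 'p) module_scheme \<Rightarrow> ('g \<Rightarrow> 'a \<Rightarrow> 'a)
      \<Rightarrow> 'a set \<Rightarrow> 'a set" where
  "invariant_quotient_map G A \<sigma> P = P \<inter> carrier (invariant_ring G A \<sigma>)"

end

theory Submission
  imports Defs
begin

text \<open>Let \<open>A\<close> be the coordinate ring of \<open>X\<close> and \<open>B\<close> its ring of invariants. The point is that an integral
  fraction over \<open>B\<close> can be extended across \<open>\<pi>\<^sup>-\<^sup>1(Z)\<close> in \<open>X\<close>, where Serre's condition is available,
  instead of across \<open>Z\<close> in the quotient.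

  By \<open>(S\<^sub>1)\<close> and irreducibility, the nilradical of \<open>A\<close> is its only associated prime, so that the
  zero divisors of \<open>A\<close> are nilpotent (\<open>zero_divisor_generic\<close>, \<open>generic_nilpotent\<close>). Since
  \<open>\<pi>\<^sup>-\<^sup>1(Z)\<close> has positive codimension, \<open>U\<close> contains the image of the generic point of \<open>X\<close>. The local
  ring there is a domain into which \<open>B\<close> embeds; hence \<open>B\<close> is a domain, and its nonzero elements are
  not zero divisors in \<open>A\<close>.

  Now let a fraction be integral over a local ring of \<open>B\<close>. After multiplication by a denominator
  it is integral over \<open>B\<close>, say \<open>a / s\<close>. By normality of \<open>U\<close>, each point of \<open>U\<close> avoids some \<open>d\<close> in \<open>B\<close>
  with \<open>d a\<close> in \<open>s B\<close>. In \<open>A\<close>, the ideal of all \<open>d\<close> with \<open>d a\<close> in \<open>s A\<close> therefore defines a closed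
  subset of \<open>\<pi>\<^sup>-\<^sup>1(Z)\<close>, of codimension at least two. If this ideal were proper, it would be contained
  in an associated prime of \<open>s A\<close>, at which \<open>A\<close> has depth at least two by \<open>(S\<^sub>2)\<close>; but an associated
  prime of a nonzerodivisor has depth one (\<open>divides_if_codim_2\<close>). So \<open>a = s f\<close> for some \<open>f\<close> in \<open>A\<close>, and
  \<open>f\<close> is invariant because \<open>a\<close> and \<open>s\<close> are and \<open>s\<close> can be cancelled. Thus \<open>a / s\<close> is in \<open>B\<close>.

  Associated primes require that \<open>A\<close> is Noetherian; this is Hilbert's basis theorem
  (\<open>noetherian_finite_type_algebra\<close>). Normality of the local rings of \<open>B\<close> is handled through
  equations in \<open>B\<close> with cleared denominators (\<open>normal_domain_localization_iff\<close>).\<close>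

section \<open>Ideals of subrings and the maximum condition\<close>

text \<open>Closure under negatives comes for free, because an ideal absorbs multiplication by \<open>\<ominus> \<one>\<close>.\<close>

lemma (in ring) idealI_closed:
  assumes sub: "I \<subseteq> carrier R" and zero: "\<zero> \<in> I"
    and add: "\<And>x y. x \<in> I \<Longrightarrow> y \<in> I \<Longrightarrow> x \<oplus> y \<in> I"
    and left: "\<And>r x. r \<in> carrier R \<Longrightarrow> x \<in> I \<Longrightarrow> r \<otimes> x \<in> I"
    and right: "\<And>r x. r \<in> carrier R \<Longrightarrow> x \<in> I \<Longrightarrow> x \<otimes> r \<in> I"
  shows "ideal I R"
proof (rule idealI[OF ring_axioms _ left right])
  have minus: "\<ominus> x \<in> I" if "x \<in> I" for x
  proof -
    have "\<ominus> x = (\<ominus> \<one>) \<otimes> x" using that sub l_minus[of \<one> x] by auto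
    then show ?thesis using left[of "\<ominus> \<one>" x] that by simp
  qed
  show "subgroup I (add_monoid R)"
    by (rule add.subgroupI) (use sub zero add minus in \<open>auto simp: a_inv_def\<close>)
qed auto

lemma (in cring) ideal_of_subringI:
  assumes T: "subring T R" and "I \<subseteq> T" and "\<zero> \<in> I"
    and "\<And>x y. x \<in> I \<Longrightarrow> y \<in> I \<Longrightarrow> x \<oplus> y \<in> I"
    and "\<And>r x. r \<in> T \<Longrightarrow> x \<in> I \<Longrightarrow> r \<otimes> x \<in> I"
  shows "ideal I (R\<lparr>carrier := T\<rparr>)"
proof -
  interpret T: ring "R\<lparr>carrier := T\<rparr>" by (rule subring_is_ring[OF T])
  have "T \<subseteq> carrier R" using subringE(1)[OF T] .
  then show ?thesis
    using assms by (intro T.idealI_closed) (auto, metis m_comm subsetD)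
qed

lemma ideal_of_subringD:
  assumes "ideal I (R\<lparr>carrier := T\<rparr>)"
  shows "I \<subseteq> T" and "\<zero>\<^bsub>R\<^esub> \<in> I"
    and "\<And>x y. x \<in> I \<Longrightarrow> y \<in> I \<Longrightarrow> x \<oplus>\<^bsub>R\<^esub> y \<in> I"
    and "\<And>r x. r \<in> T \<Longrightarrow> x \<in> I \<Longrightarrow> r \<otimes>\<^bsub>R\<^esub> x \<in> I"
proof -
  interpret I: ideal I "R\<lparr>carrier := T\<rparr>" by fact
  show "I \<subseteq> T" using I.a_subset by simp
  show "\<zero>\<^bsub>R\<^esub> \<in> I" using additive_subgroup.zero_closed[OF I.is_additive_subgroup] by simp
  show "\<And>x y. x \<in> I \<Longrightarrow> y \<in> I \<Longrightarrow> x \<oplus>\<^bsub>R\<^esub> y \<in> I" using additive_subgroup.a_closed[OF I.is_additive_subgroup] by simp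
  show "\<And>r x. r \<in> T \<Longrightarrow> x \<in> I \<Longrightarrow> r \<otimes>\<^bsub>R\<^esub> x \<in> I" using I.I_l_closed by simp
qed

text \<open>The maximum condition on families of ideals. It is the form in which the Noetherian property
  produces associated primes below.\<close>

lemma (in noetherian_ring) exists_maximal_ideal_in:
  assumes "\<I> \<noteq> {}" and "\<And>I. I \<in> \<I> \<Longrightarrow> ideal I R"
  shows "\<exists>M\<in>\<I>. \<forall>I\<in>\<I>. M \<subseteq> I \<longrightarrow> I = M"
proof (rule subset_Zorn)
  fix C assume C: "subset.chain \<I> C"
  show "\<exists>U\<in>\<I>. \<forall>I\<in>C. I \<subseteq> U"
  proof (cases "C = {}")
    case True
    then show ?thesis using assms(1) by auto
  next
    case False
    have "subset.chain {I. ideal I R} C"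
      using C assms(2) unfolding pred_on.chain_def by auto
    from ideal_chain_is_trivial[OF False this] have "\<Union>C \<in> \<I>"
      using C unfolding pred_on.chain_def by auto
    then show ?thesis by auto
  qed
qed

section \<open>Algebras of finite type are Noetherian\<close>

context cring
begin

text \<open>The values at \<open>x\<close> of the polynomials of degree below \<open>d\<close> with coefficients in \<open>S\<close>. Working with
  values, inside an ambient ring, avoids polynomial rings and their quotients: the proof of
  Hilbert's basis theorem goes through although neither the degree nor the leading coefficient of
  a value is well defined.\<close>

primrec poly_exprs :: "'a set \<Rightarrow> 'a \<Rightarrow> nat \<Rightarrow> 'a set" where
  "poly_exprs S x 0 = {\<zero>}"
| "poly_exprs S x (Suc d) = {r \<otimes> x [^] d \<oplus> m | r m. r \<in> S \<and> m \<in> poly_exprs S x d}"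

text \<open>The coefficient may be zero, so that these sets are ideals of \<open>S\<close>.\<close>

definition leading_coeffs :: "'a set \<Rightarrow> 'a \<Rightarrow> 'a set \<Rightarrow> nat \<Rightarrow> 'a set" where
  "leading_coeffs S x I d = {r \<in> S. \<exists>m \<in> poly_exprs S x d. r \<otimes> x [^] d \<oplus> m \<in> I}"

lemma leading_coeffsI:
  "r \<in> S \<Longrightarrow> m \<in> poly_exprs S x d \<Longrightarrow> r \<otimes> x [^] d \<oplus> m \<in> I \<Longrightarrow> r \<in> leading_coeffs S x I d"
  unfolding leading_coeffs_def by auto

context
  fixes S x
  assumes S: "subring S R" and x: "x \<in> carrier R"
begin

lemma S_carr: "r \<in> S \<Longrightarrow> r \<in> carrier R"
  using subringE(1)[OF S] by auto

lemma poly_exprs_carr: "m \<in> poly_exprs S x d \<Longrightarrow> m \<in> carrier R"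
  by (induction d arbitrary: m) (auto simp: S_carr x)

lemma poly_exprs_Suc: "poly_exprs S x d \<subseteq> poly_exprs S x (Suc d)"
proof
  fix m assume m: "m \<in> poly_exprs S x d"
  have "m = \<zero> \<otimes> x [^] d \<oplus> m" using poly_exprs_carr[OF m] x by simp
  then show "m \<in> poly_exprs S x (Suc d)" using m subringE(2)[OF S] by auto
qed

lemma poly_exprs_mono: "d \<le> e \<Longrightarrow> poly_exprs S x d \<subseteq> poly_exprs S x e"
  using lift_Suc_mono_le[of "poly_exprs S x"] poly_exprs_Suc by blast

lemma zero_poly_exprs: "\<zero> \<in> poly_exprs S x d"
  using poly_exprs_mono[of 0 d] by simp

lemma poly_exprs_add:
  "m \<in> poly_exprs S x d \<Longrightarrow> n \<in> poly_exprs S x d \<Longrightarrow> m \<oplus> n \<in> poly_exprs S x d"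
proof (induction d arbitrary: m n)
  case (Suc d)
  then obtain r m' s n' where
    m: "r \<in> S" "m' \<in> poly_exprs S x d" "m = r \<otimes> x [^] d \<oplus> m'" and
    n: "s \<in> S" "n' \<in> poly_exprs S x d" "n = s \<otimes> x [^] d \<oplus> n'"
    by auto
  have "m \<oplus> n = (r \<oplus> s) \<otimes> x [^] d \<oplus> (m' \<oplus> n')"
    using m n x by (simp add: S_carr poly_exprs_carr l_distr a_ac)
  then show ?case
    using Suc.IH[OF m(2) n(2)] subringE(7)[OF S m(1) n(1)] by auto
qed auto

lemma poly_exprs_scale:
  "r \<in> S \<Longrightarrow> m \<in> poly_exprs S x d \<Longrightarrow> r \<otimes> m \<in> poly_exprs S x d"
proof (induction d arbitrary: m)
  case (Suc d)
  then obtain s m' where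
    m: "s \<in> S" "m' \<in> poly_exprs S x d" "m = s \<otimes> x [^] d \<oplus> m'"
    by auto
  have "r \<otimes> m = (r \<otimes> s) \<otimes> x [^] d \<oplus> r \<otimes> m'"
    using m Suc.prems(1) x by (simp add: S_carr poly_exprs_carr r_distr m_assoc)
  then show ?case
    using Suc.IH[OF Suc.prems(1) m(2)] subringE(6)[OF S Suc.prems(1) m(1)] by auto
qed (auto simp: S_carr)

lemma poly_exprs_shift:
  "m \<in> poly_exprs S x d \<Longrightarrow> x \<otimes> m \<in> poly_exprs S x (Suc d)"
proof (induction d arbitrary: m)
  case 0
  then show ?case using x zero_poly_exprs[of 1] by auto
next
  case (Suc d)
  then obtain s m' where
    m: "s \<in> S" "m' \<in> poly_exprs S x d" "m = s \<otimes> x [^] d \<oplus> m'"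
    by auto
  have "x \<otimes> m = s \<otimes> x [^] Suc d \<oplus> x \<otimes> m'"
    using m x by (simp add: S_carr poly_exprs_carr r_distr m_ac)
  then show ?case
    using Suc.IH[OF m(2)] m(1) by auto
qed

lemma poly_exprs_shifts:
  "m \<in> poly_exprs S x d \<Longrightarrow> x [^] k \<otimes> m \<in> poly_exprs S x (k + d)"
proof (induction k)
  case 0
  then show ?case by (simp add: poly_exprs_carr)
next
  case (Suc k)
  have "x [^] Suc k \<otimes> m = x \<otimes> (x [^] k \<otimes> m)"
    using x poly_exprs_carr[OF Suc.prems] by (simp add: m_ac)
  then show ?case using poly_exprs_shift[OF Suc.IH[OF Suc.prems]] by simp
qed

definition adjoined :: "'a set" where "adjoined = (\<Union>d. poly_exprs S x d)"

lemma poly_exprs_adjoined: "poly_exprs S x d \<subseteq> adjoined"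
  unfolding adjoined_def by auto

lemma adjoined_carr: "adjoined \<subseteq> carrier R"
  unfolding adjoined_def using poly_exprs_carr by auto

lemma adjoined_add: "m \<in> adjoined \<Longrightarrow> n \<in> adjoined \<Longrightarrow> m \<oplus> n \<in> adjoined"
proof -
  assume "m \<in> adjoined" "n \<in> adjoined"
  then obtain d e where "m \<in> poly_exprs S x d" "n \<in> poly_exprs S x e"
    unfolding adjoined_def by auto
  then have "m \<in> poly_exprs S x (max d e)" "n \<in> poly_exprs S x (max d e)"
    using poly_exprs_mono[of d "max d e"] poly_exprs_mono[of e "max d e"] by auto
  then show ?thesis using poly_exprs_add poly_exprs_adjoined by blast
qed

lemma base_poly_exprs: "r \<in> S \<Longrightarrow> r \<in> poly_exprs S x 1"
  using S_carr by force

lemma adjoined_base: "S \<subseteq> adjoined"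
  using base_poly_exprs poly_exprs_adjoined by blast

lemma adjoined_gen: "x \<in> adjoined"
proof -
  from poly_exprs_shift[OF base_poly_exprs[OF subringE(3)[OF S]]] have "x \<in> poly_exprs S x 2"
    using x by (simp add: numeral_2_eq_2)
  then show ?thesis using poly_exprs_adjoined by blast
qed

lemma adjoined_mult: "m \<in> adjoined \<Longrightarrow> n \<in> adjoined \<Longrightarrow> m \<otimes> n \<in> adjoined"
proof -
  assume m: "m \<in> adjoined" and n: "n \<in> adjoined"
  have "m \<otimes> n \<in> adjoined" if "m \<in> poly_exprs S x d" for d
    using that
  proof (induction d arbitrary: m)
    case 0
    have "n \<in> carrier R" using n adjoined_carr by auto
    then have "m \<otimes> n \<in> poly_exprs S x 0" using 0 by simp
    then show ?case using poly_exprs_adjoined by blast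
  next
    case (Suc d)
    then obtain r m' where
      m: "r \<in> S" "m' \<in> poly_exprs S x d" "m = r \<otimes> x [^] d \<oplus> m'"
      by auto
    obtain e where e: "n \<in> poly_exprs S x e" using n unfolding adjoined_def by auto
    have "m \<otimes> n = r \<otimes> (x [^] d \<otimes> n) \<oplus> m' \<otimes> n"
      using m x poly_exprs_carr[OF e] by (simp add: S_carr poly_exprs_carr l_distr m_assoc)
    moreover have "r \<otimes> (x [^] d \<otimes> n) \<in> adjoined"
      using poly_exprs_scale[OF m(1) poly_exprs_shifts[OF e]] poly_exprs_adjoined by blast
    ultimately show ?case using Suc.IH[OF m(2)] adjoined_add by simp
  qed
  then show ?thesis using m unfolding adjoined_def by auto
qed

lemma adjoined_subring: "subring adjoined R"
proof (rule subringI)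
  show "adjoined \<subseteq> carrier R" by (rule adjoined_carr)
  show one: "\<one> \<in> adjoined" using adjoined_base subringE(3)[OF S] by auto
  fix h assume h: "h \<in> adjoined"
  have "\<ominus> h = (\<ominus> \<one>) \<otimes> h" using h adjoined_carr l_minus[of \<one> h] by auto
  moreover have "\<ominus> \<one> \<in> adjoined" using adjoined_base subringE(3,5)[OF S] by auto
  ultimately show "\<ominus> h \<in> adjoined" using adjoined_mult h by simp
qed (auto intro: adjoined_mult adjoined_add)

lemma leading_coeffs_ideal:
  assumes I: "ideal I (R\<lparr>carrier := adjoined\<rparr>)"
  shows "ideal (leading_coeffs S x I d) (R\<lparr>carrier := S\<rparr>)"
proof (rule ideal_of_subringI[OF S])
  show "leading_coeffs S x I d \<subseteq> S" unfolding leading_coeffs_def by auto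
  show "\<zero> \<in> leading_coeffs S x I d"
    unfolding leading_coeffs_def using zero_poly_exprs ideal_of_subringD(2)[OF I] subringE(2)[OF S] x
    by (auto intro!: bexI[of _ \<zero>])
next
  fix r s assume "r \<in> leading_coeffs S x I d" "s \<in> leading_coeffs S x I d"
  then obtain m n where r: "r \<in> S" "m \<in> poly_exprs S x d" "r \<otimes> x [^] d \<oplus> m \<in> I"
    and s: "s \<in> S" "n \<in> poly_exprs S x d" "s \<otimes> x [^] d \<oplus> n \<in> I"
    unfolding leading_coeffs_def by auto
  have "(r \<oplus> s) \<otimes> x [^] d \<oplus> (m \<oplus> n) = (r \<otimes> x [^] d \<oplus> m) \<oplus> (s \<otimes> x [^] d \<oplus> n)"
    using r s x by (simp add: S_carr poly_exprs_carr l_distr a_ac)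
  then show "r \<oplus> s \<in> leading_coeffs S x I d"
    using ideal_of_subringD(3)[OF I r(3) s(3)] poly_exprs_add[OF r(2) s(2)] subringE(7)[OF S r(1) s(1)]
    by (intro leading_coeffsI) auto
next
  fix s r assume s: "s \<in> S" and "r \<in> leading_coeffs S x I d"
  then obtain m where r: "r \<in> S" "m \<in> poly_exprs S x d" "r \<otimes> x [^] d \<oplus> m \<in> I"
    unfolding leading_coeffs_def by auto
  have "(s \<otimes> r) \<otimes> x [^] d \<oplus> s \<otimes> m = s \<otimes> (r \<otimes> x [^] d \<oplus> m)"
    using r s x by (simp add: S_carr poly_exprs_carr r_distr m_assoc)
  then show "s \<otimes> r \<in> leading_coeffs S x I d"
    using ideal_of_subringD(4)[OF I _ r(3)] s adjoined_base poly_exprs_scale[OF s r(2)]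
      subringE(6)[OF S s r(1)]
    by (intro leading_coeffsI) auto
qed

text \<open>Multiplication by \<open>x\<close> raises the degree and keeps the leading coefficient.\<close>

lemma leading_coeffs_Suc:
  assumes I: "ideal I (R\<lparr>carrier := adjoined\<rparr>)"
  shows "leading_coeffs S x I d \<subseteq> leading_coeffs S x I (Suc d)"
proof
  fix r assume "r \<in> leading_coeffs S x I d"
  then obtain m where r: "r \<in> S" "m \<in> poly_exprs S x d" "r \<otimes> x [^] d \<oplus> m \<in> I"
    unfolding leading_coeffs_def by auto
  have "r \<otimes> x [^] Suc d \<oplus> x \<otimes> m = x \<otimes> (r \<otimes> x [^] d \<oplus> m)"
    using r x by (simp add: S_carr poly_exprs_carr r_distr m_ac)
  then show "r \<in> leading_coeffs S x I (Suc d)"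
    using ideal_of_subringD(4)[OF I adjoined_gen r(3)] poly_exprs_shift[OF r(2)] r(1)
    by (intro leading_coeffsI) (auto simp del: poly_exprs.simps)
qed

lemma leading_coeffs_mono:
  assumes "ideal I (R\<lparr>carrier := adjoined\<rparr>)" and "d \<le> e"
  shows "leading_coeffs S x I d \<subseteq> leading_coeffs S x I e"
  using lift_Suc_mono_le[of "leading_coeffs S x I"] leading_coeffs_Suc[OF assms(1)] assms(2) by blast

text \<open>An element of \<open>I\<close> loses its leading term when a suitable element of \<open>J\<close> is subtracted. As
  \<open>J \<subseteq> I\<close>, the difference is again in \<open>I\<close>, and it has lower degree.\<close>

lemma ideal_subset_if_leading_coeffs_subset:
  assumes I: "ideal I (R\<lparr>carrier := adjoined\<rparr>)" and J: "ideal J (R\<lparr>carrier := adjoined\<rparr>)"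
    and "J \<subseteq> I" and L: "\<And>d. leading_coeffs S x I d \<subseteq> leading_coeffs S x J d"
  shows "I \<subseteq> J"
proof -
  have "f \<in> J" if "f \<in> I" "f \<in> poly_exprs S x d" for f d
    using that
  proof (induction d arbitrary: f)
    case 0
    then show ?case using ideal_of_subringD(2)[OF J] by auto
  next
    case (Suc d)
    from Suc.prems(2) obtain r m where
      f: "r \<in> S" "m \<in> poly_exprs S x d" "f = r \<otimes> x [^] d \<oplus> m"
      by auto
    then have "r \<in> leading_coeffs S x J d"
      using L Suc.prems(1) unfolding leading_coeffs_def by blast
    then obtain n where n: "n \<in> poly_exprs S x d" "r \<otimes> x [^] d \<oplus> n \<in> J"
      unfolding leading_coeffs_def by auto
    define g where "g = r \<otimes> x [^] d \<oplus> n"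
    have m1: "\<ominus> \<one> \<in> S" using subringE(3,5)[OF S] by auto
    then have m1': "\<ominus> \<one> \<in> adjoined" using adjoined_base by auto
    have neg: "(\<ominus> \<one>) \<otimes> y = \<ominus> y" if "y \<in> carrier R" for y
      using that l_minus[of \<one> y] by auto
    have carr: "r \<otimes> x [^] d \<in> carrier R" "m \<in> carrier R" "n \<in> carrier R" "g \<in> carrier R"
      using f n x by (auto simp: S_carr poly_exprs_carr g_def)
    have "f \<oplus> (\<ominus> \<one>) \<otimes> g = m \<oplus> (\<ominus> \<one>) \<otimes> n"
      unfolding neg[OF carr(4)] neg[OF carr(3)] unfolding f(3) g_def using carr by algebra
    moreover have "m \<oplus> (\<ominus> \<one>) \<otimes> n \<in> poly_exprs S x d"
      using poly_exprs_add[OF f(2) poly_exprs_scale[OF m1 n(1)]] .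
    moreover have "f \<oplus> (\<ominus> \<one>) \<otimes> g \<in> I"
      using ideal_of_subringD(3,4)[OF I] m1' Suc.prems(1) n(2) \<open>J \<subseteq> I\<close> by (auto simp: g_def)
    ultimately have "f \<oplus> (\<ominus> \<one>) \<otimes> g \<in> J" using Suc.IH by auto
    then have "(f \<oplus> (\<ominus> \<one>) \<otimes> g) \<oplus> g \<in> J"
      using ideal_of_subringD(3)[OF J] n(2) g_def by auto
    moreover have "f \<in> carrier R" using f carr by auto
    then have "(f \<oplus> (\<ominus> \<one>) \<otimes> g) \<oplus> g = f" unfolding neg[OF carr(4)] using carr by algebra
    ultimately show ?case by simp
  qed
  then show ?thesis using ideal_of_subringD(1)[OF I] unfolding adjoined_def by auto
qed

text \<open>Hilbert's basis theorem. The ideals of leading coefficients form an ascending chain in \<open>S\<close>, which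
  stops at some degree \<open>N\<close>. Elements of \<open>I\<close> of degrees up to \<open>N\<close> whose leading coefficients generate
  these finitely many ideals then generate an ideal with the same leading coefficients as \<open>I\<close> in
  every degree, hence \<open>I\<close> itself.\<close>

lemma noetherian_adjoined:
  assumes N: "noetherian_ring (R\<lparr>carrier := S\<rparr>)"
  shows "noetherian_ring (R\<lparr>carrier := adjoined\<rparr>)"
proof -
  interpret S: noetherian_ring "R\<lparr>carrier := S\<rparr>" by fact
  interpret T: ring "R\<lparr>carrier := adjoined\<rparr>" by (rule subring_is_ring[OF adjoined_subring])
  show ?thesis
  proof (rule T.noetherian_ringI)
    fix I assume I: "ideal I (R\<lparr>carrier := adjoined\<rparr>)"
    let ?L = "leading_coeffs S x I"
    have "?L d \<subseteq> ?L e \<or> ?L e \<subseteq> ?L d" for d e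
      using leading_coeffs_mono[OF I] by (metis nle_le)
    then have "subset.chain {I. ideal I (R\<lparr>carrier := S\<rparr>)} (range ?L)"
      using leading_coeffs_ideal[OF I] by (force simp: pred_on.chain_def)
    then have "\<Union>(range ?L) \<in> range ?L" by (intro S.ideal_chain_is_trivial) auto
    then obtain N where N: "\<Union>(range ?L) = ?L N" by auto
    \<comment> \<open>For every degree, finitely many elements of the ideal realise generators of its leading coefficients.\<close>
    have gens: "\<exists>F. finite F \<and> F \<subseteq> I \<and> ?L d \<subseteq> genideal (R\<lparr>carrier := S\<rparr>)
            {r \<in> S. \<exists>m \<in> poly_exprs S x d. r \<otimes> x [^] d \<oplus> m \<in> F}" for d
    proof -
      obtain B where B: "B \<subseteq> S" "finite B" "?L d = genideal (R\<lparr>carrier := S\<rparr>) B"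
        using S.finetely_gen[OF leading_coeffs_ideal[OF I, of d]] by auto
      then have "B \<subseteq> ?L d" using S.genideal_self by auto
      then have "\<forall>r\<in>B. \<exists>m. m \<in> poly_exprs S x d \<and> r \<otimes> x [^] d \<oplus> m \<in> I"
        unfolding leading_coeffs_def by auto
      then obtain m where m: "\<And>r. r \<in> B \<Longrightarrow> m r \<in> poly_exprs S x d \<and> r \<otimes> x [^] d \<oplus> m r \<in> I"
        by metis
      let ?F = "(\<lambda>r. r \<otimes> x [^] d \<oplus> m r) ` B"
      let ?C = "{r \<in> S. \<exists>m \<in> poly_exprs S x d. r \<otimes> x [^] d \<oplus> m \<in> ?F}"
      have "B \<subseteq> ?C" using m B by auto
      then have "genideal (R\<lparr>carrier := S\<rparr>) B \<subseteq> genideal (R\<lparr>carrier := S\<rparr>) ?C"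
        by (intro S.subset_Idl_subset) auto
      then have "?L d \<subseteq> genideal (R\<lparr>carrier := S\<rparr>) ?C" using B(3) by simp
      then show ?thesis using m B by (intro exI[of _ ?F]) auto
    qed
    have "\<exists>F. \<forall>d. finite (F d) \<and> F d \<subseteq> I \<and> ?L d \<subseteq> genideal (R\<lparr>carrier := S\<rparr>)
            {r \<in> S. \<exists>m \<in> poly_exprs S x d. r \<otimes> x [^] d \<oplus> m \<in> F d}"
      by (rule choice, rule allI, rule gens)
    then obtain F where F: "\<forall>d. finite (F d) \<and> F d \<subseteq> I \<and> ?L d \<subseteq> genideal (R\<lparr>carrier := S\<rparr>)
            {r \<in> S. \<exists>m \<in> poly_exprs S x d. r \<otimes> x [^] d \<oplus> m \<in> F d}"
      by (elim exE)
    define E where "E = (\<Union>d\<le>N. F d)"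
    have E: "finite E" "E \<subseteq> I" "E \<subseteq> adjoined"
      unfolding E_def using F ideal_of_subringD(1)[OF I] by auto
    define J where "J = genideal (R\<lparr>carrier := adjoined\<rparr>) E"
    have J: "ideal J (R\<lparr>carrier := adjoined\<rparr>)" unfolding J_def using E T.genideal_ideal by auto
    have "J \<subseteq> I" unfolding J_def using T.genideal_minimal[OF I E(2)] .
    have "E \<subseteq> J" unfolding J_def using T.genideal_self E by auto
    have low: "?L d \<subseteq> leading_coeffs S x J d" if "d \<le> N" for d
    proof -
      have "{r \<in> S. \<exists>m \<in> poly_exprs S x d. r \<otimes> x [^] d \<oplus> m \<in> F d} \<subseteq> leading_coeffs S x J d"
        using \<open>E \<subseteq> J\<close> that unfolding leading_coeffs_def E_def by auto
      from S.genideal_minimal[OF leading_coeffs_ideal[OF J] this] F[rule_format, of d]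
      show ?thesis by auto
    qed
    have "?L d \<subseteq> leading_coeffs S x J d" for d
    proof (cases "d \<le> N")
      case False
      have "?L d \<subseteq> ?L N" using N by auto
      then show ?thesis using low[of N] leading_coeffs_mono[OF J, of N d] False by auto
    qed (rule low)
    from ideal_subset_if_leading_coeffs_subset[OF I J \<open>J \<subseteq> I\<close> this]
    have "I = J" using \<open>J \<subseteq> I\<close> by auto
    then show "\<exists>A\<subseteq>carrier (R\<lparr>carrier := adjoined\<rparr>). finite A \<and> I = genideal (R\<lparr>carrier := adjoined\<rparr>) A"
      using E J_def by auto
  qed
qed

end

lemma exists_noetherian_overring:
  assumes "subring S R" and "x \<in> carrier R" and "noetherian_ring (R\<lparr>carrier := S\<rparr>)"
  shows "\<exists>T. subring T R \<and> S \<subseteq> T \<and> x \<in> T \<and> noetherian_ring (R\<lparr>carrier := T\<rparr>)"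
  using adjoined_subring[OF assms(1,2)] adjoined_base[OF assms(1,2)] adjoined_gen[OF assms(1,2)]
    noetherian_adjoined[OF assms] by blast

lemma noetherian_if_generated:
  assumes S: "subring S R" and N: "noetherian_ring (R\<lparr>carrier := S\<rparr>)"
    and "finite Y" and "Y \<subseteq> carrier R" and gen: "generate_ring R (S \<union> Y) = carrier R"
  shows "noetherian_ring R"
proof -
  have "\<exists>T. subring T R \<and> S \<union> Y \<subseteq> T \<and> noetherian_ring (R\<lparr>carrier := T\<rparr>)"
    using \<open>finite Y\<close> \<open>Y \<subseteq> carrier R\<close>
  proof induction
    case empty
    then show ?case using S N by auto
  next
    case (insert x Y)
    then obtain T where T: "subring T R" "S \<union> Y \<subseteq> T" "noetherian_ring (R\<lparr>carrier := T\<rparr>)"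
      by auto
    from exists_noetherian_overring[OF T(1) _ T(3), of x] insert.prems T(2)
    obtain T' where "subring T' R" "T \<subseteq> T'" "x \<in> T'" "noetherian_ring (R\<lparr>carrier := T'\<rparr>)"
      by auto
    then show ?case using T(2) by (intro exI[of _ T']) auto
  qed
  then obtain T where T: "subring T R" "S \<union> Y \<subseteq> T" "noetherian_ring (R\<lparr>carrier := T\<rparr>)"
    by auto
  have "generate_ring R (S \<union> Y) \<subseteq> T"
  proof
    fix y assume "y \<in> generate_ring R (S \<union> Y)"
    then show "y \<in> T"
      by induction (use T(2) subringE[OF T(1)] in auto)
  qed
  then have "T = carrier R" using gen subringE(1)[OF T(1)] by auto
  then show ?thesis using T(3) by simp
qed

end

text \<open>The induction on the generators starts at the image of \<open>K\<close>, whose only ideals are zero and the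
  whole ring.\<close>

lemma noetherian_finite_type_algebra:
  assumes K: "field K" and A: "finite_type_algebra K A"
  shows "noetherian_ring A"
proof -
  interpret K: field K by fact
  interpret A: algebra K A using A unfolding finite_type_algebra_def by auto
  interpret A: cring A by (rule A.is_cring)
  let ?S = "(\<lambda>k. k \<odot>\<^bsub>A\<^esub> \<one>\<^bsub>A\<^esub>) ` carrier K"
  have mult: "(k \<odot>\<^bsub>A\<^esub> \<one>\<^bsub>A\<^esub>) \<otimes>\<^bsub>A\<^esub> (l \<odot>\<^bsub>A\<^esub> \<one>\<^bsub>A\<^esub>) = (k \<otimes>\<^bsub>K\<^esub> l) \<odot>\<^bsub>A\<^esub> \<one>\<^bsub>A\<^esub>"
    if "k \<in> carrier K" "l \<in> carrier K" for k l
    using that by (simp add: A.smult_assoc2 A.smult_assoc1)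
  have S: "subring ?S A"
  proof (rule A.subringI)
    show "?S \<subseteq> carrier A" by auto
    show "\<one>\<^bsub>A\<^esub> \<in> ?S" by (intro image_eqI[of _ _ "\<one>\<^bsub>K\<^esub>"]) auto
    fix h assume "h \<in> ?S"
    then obtain k where k: "k \<in> carrier K" "h = k \<odot>\<^bsub>A\<^esub> \<one>\<^bsub>A\<^esub>" by auto
    then have "\<ominus>\<^bsub>A\<^esub> h = (\<ominus>\<^bsub>K\<^esub> k) \<odot>\<^bsub>A\<^esub> \<one>\<^bsub>A\<^esub>"
      by (simp add: A.smult_l_minus)
    then show "\<ominus>\<^bsub>A\<^esub> h \<in> ?S" using k by auto
    fix h' assume "h' \<in> ?S"
    then obtain l where l: "l \<in> carrier K" "h' = l \<odot>\<^bsub>A\<^esub> \<one>\<^bsub>A\<^esub>" by auto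
    show "h \<otimes>\<^bsub>A\<^esub> h' \<in> ?S" using mult k l by auto
    have "h \<oplus>\<^bsub>A\<^esub> h' = (k \<oplus>\<^bsub>K\<^esub> l) \<odot>\<^bsub>A\<^esub> \<one>\<^bsub>A\<^esub>"
      using k l by (simp add: A.smult_l_distr)
    then show "h \<oplus>\<^bsub>A\<^esub> h' \<in> ?S" using k l by auto
  qed
  interpret S: ring "A\<lparr>carrier := ?S\<rparr>" by (rule A.subring_is_ring[OF S])
  have "noetherian_ring (A\<lparr>carrier := ?S\<rparr>)"
  proof (rule S.noetherian_ringI)
    fix I assume I: "ideal I (A\<lparr>carrier := ?S\<rparr>)"
    note ID = ideal_of_subringD[OF I]
    show "\<exists>B\<subseteq>carrier (A\<lparr>carrier := ?S\<rparr>). finite B \<and> I = genideal (A\<lparr>carrier := ?S\<rparr>) B"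
    proof (cases "I \<subseteq> {\<zero>\<^bsub>A\<^esub>}")
      case True
      then have "I = {\<zero>\<^bsub>A\<^esub>}" using ID(2) by auto
      then have "I = genideal (A\<lparr>carrier := ?S\<rparr>) {\<zero>\<^bsub>A\<^esub>}" using S.genideal_zero by simp
      then show ?thesis using subringE(2)[OF S] by (intro exI[of _ "{\<zero>\<^bsub>A\<^esub>}"]) auto
    next
      case False
      then obtain k where k: "k \<in> carrier K" "k \<odot>\<^bsub>A\<^esub> \<one>\<^bsub>A\<^esub> \<in> I" "k \<odot>\<^bsub>A\<^esub> \<one>\<^bsub>A\<^esub> \<noteq> \<zero>\<^bsub>A\<^esub>"
        using ID(1) by blast
      then have "k \<noteq> \<zero>\<^bsub>K\<^esub>" by auto
      then have ik: "inv\<^bsub>K\<^esub> k \<in> carrier K" "inv\<^bsub>K\<^esub> k \<otimes>\<^bsub>K\<^esub> k = \<one>\<^bsub>K\<^esub>"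
        using k K.field_Units by auto
      then have "\<one>\<^bsub>A\<^esub> = (inv\<^bsub>K\<^esub> k \<odot>\<^bsub>A\<^esub> \<one>\<^bsub>A\<^esub>) \<otimes>\<^bsub>A\<^esub> (k \<odot>\<^bsub>A\<^esub> \<one>\<^bsub>A\<^esub>)"
        using mult[OF ik(1) k(1)] by simp
      moreover have "(inv\<^bsub>K\<^esub> k \<odot>\<^bsub>A\<^esub> \<one>\<^bsub>A\<^esub>) \<otimes>\<^bsub>A\<^esub> (k \<odot>\<^bsub>A\<^esub> \<one>\<^bsub>A\<^esub>) \<in> I"
        using ID(4) k(2) ik(1) by blast
      ultimately have "\<one>\<^bsub>A\<^esub> \<in> I" by simp
      then have "I = carrier (A\<lparr>carrier := ?S\<rparr>)" using ideal.one_imp_carrier[OF I] by simp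
      then have "I = genideal (A\<lparr>carrier := ?S\<rparr>) {\<one>\<^bsub>A\<^esub>}" using S.genideal_one by simp
      then show ?thesis using subringE(3)[OF S] by (intro exI[of _ "{\<one>\<^bsub>A\<^esub>}"]) auto
    qed
  qed
  then show ?thesis
    using A A.noetherian_if_generated[OF S] unfolding finite_type_algebra_def by blast
qed

section \<open>Localization at a prime ideal\<close>

text \<open>The later arguments do not look into fractions. They use that \<open>\<rho>\<close> is a homomorphism to a
  commutative ring, that it maps denominators to units, that its kernel consists of the elements
  annihilated by a denominator, and that every element of the localization has the form
  \<open>\<rho> a / \<rho> s\<close>; the latter is expressed as \<open>x \<otimes> \<rho> s = \<rho> a\<close>.\<close>

locale localization_at_prime = cring R + primeideal P R for R (structure) and P
begin

abbreviation "L \<equiv> localization R P"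
abbreviation "denominators \<equiv> carrier R - P"
definition "\<rho> r = frac R P r \<one>"

lemma one_denominator: "\<one> \<in> denominators"
  using I_notcarr one_imp_carrier by auto

lemma denominators_mult: "s \<in> denominators \<Longrightarrow> t \<in> denominators \<Longrightarrow> s \<otimes> t \<in> denominators"
  using I_prime by auto

text \<open>The multiplied-out form, without subtraction, can be handled by rewriting modulo associativity
  and commutativity.\<close>

lemma frac_rel_iff:
  "((a, s), (b, t)) \<in> frac_rel R P \<longleftrightarrow>
    a \<in> carrier R \<and> s \<in> denominators \<and> b \<in> carrier R \<and> t \<in> denominators \<and>
    (\<exists>u \<in> denominators. u \<otimes> (t \<otimes> a) = u \<otimes> (s \<otimes> b))"
proof -
  have "u \<otimes> (t \<otimes> a \<ominus> s \<otimes> b) = \<zero> \<longleftrightarrow> u \<otimes> (t \<otimes> a) = u \<otimes> (s \<otimes> b)"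
    if "a \<in> carrier R" "s \<in> carrier R" "b \<in> carrier R" "t \<in> carrier R" "u \<in> carrier R" for u
  proof -
    have "u \<otimes> (t \<otimes> a \<ominus> s \<otimes> b) = u \<otimes> (t \<otimes> a) \<ominus> u \<otimes> (s \<otimes> b)"
      using that by (simp add: minus_eq r_distr r_minus)
    then show ?thesis using that by (simp add: r_right_minus_eq)
  qed
  then show ?thesis unfolding frac_rel_def by auto
qed

lemma equiv_frac_rel: "equiv (carrier R \<times> denominators) (frac_rel R P)"
proof (rule equivI)
  show "frac_rel R P \<subseteq> (carrier R \<times> denominators) \<times> (carrier R \<times> denominators)"
    unfolding frac_rel_def by auto
  show "refl_on (carrier R \<times> denominators) (frac_rel R P)"
    using one_denominator by (intro refl_onI) (auto simp: frac_rel_iff)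
  show "sym (frac_rel R P)"
    by (rule symI) (force simp: frac_rel_iff)
  show "trans (frac_rel R P)"
  proof (rule transI)
    fix p q r assume pq: "(p, q) \<in> frac_rel R P" and qr: "(q, r) \<in> frac_rel R P"
    obtain a s b t c w where [simp]: "p = (a, s)" "q = (b, t)" "r = (c, w)"
      by (cases p, cases q, cases r)
    from pq obtain u where h: "a \<in> carrier R" "s \<in> denominators" "b \<in> carrier R" "t \<in> denominators"
      "u \<in> denominators" "u \<otimes> (t \<otimes> a) = u \<otimes> (s \<otimes> b)"
      by (auto simp: frac_rel_iff)
    from qr obtain v where k: "c \<in> carrier R" "w \<in> denominators"
      "v \<in> denominators" "v \<otimes> (w \<otimes> b) = v \<otimes> (t \<otimes> c)"
      by (auto simp: frac_rel_iff)
    have "(u \<otimes> v \<otimes> t) \<otimes> (w \<otimes> a) = (v \<otimes> w) \<otimes> (u \<otimes> (t \<otimes> a))"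
      using h(1-5) k(1-3) by (simp add: m_ac)
    also have "\<dots> = (u \<otimes> s) \<otimes> (v \<otimes> (w \<otimes> b))"
      unfolding h(6) using h(1-5) k(1-3) by (simp add: m_ac)
    also have "\<dots> = (u \<otimes> v \<otimes> t) \<otimes> (s \<otimes> c)"
      unfolding k(4) using h(1-5) k(1-3) by (simp add: m_ac)
    finally show "(p, r) \<in> frac_rel R P"
      using h(1-5) k(1-3) denominators_mult[OF denominators_mult[OF h(5) k(3)] h(4)]
      unfolding \<open>p = (a, s)\<close> \<open>r = (c, w)\<close> frac_rel_iff by blast
  qed
qed

lemma frac_eq_iff:
  assumes "a \<in> carrier R" "s \<in> denominators" "b \<in> carrier R" "t \<in> denominators"
  shows "frac R P a s = frac R P b t \<longleftrightarrow> (\<exists>u \<in> denominators. u \<otimes> (t \<otimes> a) = u \<otimes> (s \<otimes> b))"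
  unfolding frac_def
  by (subst eq_equiv_class_iff[OF equiv_frac_rel]) (use assms in \<open>auto simp: frac_rel_iff\<close>)

lemma frac_eqI:
  assumes "a \<in> carrier R" "s \<in> denominators" "b \<in> carrier R" "t \<in> denominators"
    and "t \<otimes> a = s \<otimes> b"
  shows "frac R P a s = frac R P b t"
  using assms one_denominator by (subst frac_eq_iff) auto

lemma frac_mem_iff:
  assumes "a \<in> carrier R" "s \<in> denominators"
  shows "(b, t) \<in> frac R P a s \<longleftrightarrow> b \<in> carrier R \<and> t \<in> denominators \<and> frac R P b t = frac R P a s"
proof -
  have "(b, t) \<in> frac R P a s \<longleftrightarrow> ((a, s), (b, t)) \<in> frac_rel R P"
    unfolding frac_def by auto
  then show ?thesis
    using assms frac_eq_iff[of a s b t] unfolding frac_rel_iff by metis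
qed

lemma carrier_L: "carrier L = {frac R P a s | a s. a \<in> carrier R \<and> s \<in> denominators}"
  unfolding localization_def frac_def quotient_def by auto

lemma frac_closed: "a \<in> carrier R \<Longrightarrow> s \<in> denominators \<Longrightarrow> frac R P a s \<in> carrier L"
  unfolding carrier_L by auto

lemma frac_cases:
  assumes "x \<in> carrier L"
  obtains a s where "a \<in> carrier R" "s \<in> denominators" "s \<in> carrier R" "x = frac R P a s"
  using assms unfolding carrier_L by auto

text \<open>The ring operations on fractions are unions over all representatives. Such a union collapses to
  its value at one pair of representatives as soon as the operation respects equality of fractions.\<close>

lemma UN_frac_const:
  fixes f :: "'a \<Rightarrow> 'a \<Rightarrow> 'a \<Rightarrow> 'a \<Rightarrow> 'c set"
  assumes h: "a \<in> carrier R" "s \<in> denominators" "b \<in> carrier R" "t \<in> denominators"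
    and cong: "\<And>a' s' b' t'. \<lbrakk>a' \<in> carrier R; s' \<in> denominators; b' \<in> carrier R; t' \<in> denominators;
       frac R P a' s' = frac R P a s; frac R P b' t' = frac R P b t\<rbrakk> \<Longrightarrow> f a' s' b' t' = f a s b t"
  shows "(\<Union>(a, s) \<in> frac R P a s. \<Union>(b, t) \<in> frac R P b t. f a s b t) = f a s b t"
proof (intro equalityI subsetI)
  fix z
  assume "z \<in> (\<Union>(a, s) \<in> frac R P a s. \<Union>(b, t) \<in> frac R P b t. f a s b t)"
  then obtain a' s' b' t' where "(a', s') \<in> frac R P a s" "(b', t') \<in> frac R P b t" "z \<in> f a' s' b' t'"
    by auto
  moreover from this(1,2) have "f a' s' b' t' = f a s b t"
    using h by (intro cong) (simp_all only: frac_mem_iff)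
  ultimately show "z \<in> f a s b t" by simp
next
  fix z
  assume "z \<in> f a s b t"
  moreover have "(a, s) \<in> frac R P a s" "(b, t) \<in> frac R P b t" using h by (auto simp: frac_mem_iff)
  ultimately show "z \<in> (\<Union>(a, s) \<in> frac R P a s. \<Union>(b, t) \<in> frac R P b t. f a s b t)" by blast
qed

lemma frac_mult:
  assumes h: "a \<in> carrier R" "s \<in> denominators" "b \<in> carrier R" "t \<in> denominators"
  shows "frac R P a s \<otimes>\<^bsub>L\<^esub> frac R P b t = frac R P (a \<otimes> b) (s \<otimes> t)"
proof -
  have "frac R P (a' \<otimes> b') (s' \<otimes> t') = frac R P (a \<otimes> b) (s \<otimes> t)"
    if k: "a' \<in> carrier R" "s' \<in> denominators" "b' \<in> carrier R" "t' \<in> denominators"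
       "frac R P a' s' = frac R P a s" "frac R P b' t' = frac R P b t" for a' s' b' t'
  proof -
    obtain u where u: "u \<in> denominators" "u \<otimes> (s \<otimes> a') = u \<otimes> (s' \<otimes> a)"
      using k(5) frac_eq_iff[OF k(1,2) h(1,2)] by auto
    obtain v where v: "v \<in> denominators" "v \<otimes> (t \<otimes> b') = v \<otimes> (t' \<otimes> b)"
      using k(6) frac_eq_iff[OF k(3,4) h(3,4)] by auto
    have "(u \<otimes> v) \<otimes> ((s \<otimes> t) \<otimes> (a' \<otimes> b')) = (u \<otimes> (s \<otimes> a')) \<otimes> (v \<otimes> (t \<otimes> b'))"
      using h k(1-4) u(1) v(1) by (simp add: m_ac)
    also have "\<dots> = (u \<otimes> v) \<otimes> ((s' \<otimes> t') \<otimes> (a \<otimes> b))"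
      unfolding u(2) v(2) using h k(1-4) u(1) v(1) by (simp add: m_ac)
    finally show ?thesis
      using h k(1-4) u(1) v(1) denominators_mult[OF u(1) v(1)] denominators_mult[OF h(2,4)]
        denominators_mult[OF k(2,4)]
      by (intro iffD2[OF frac_eq_iff]) auto
  qed
  then show ?thesis
    unfolding localization_def by (simp, intro UN_frac_const[OF h]) auto
qed

lemma frac_add:
  assumes h: "a \<in> carrier R" "s \<in> denominators" "b \<in> carrier R" "t \<in> denominators"
  shows "frac R P a s \<oplus>\<^bsub>L\<^esub> frac R P b t = frac R P (t \<otimes> a \<oplus> s \<otimes> b) (s \<otimes> t)"
proof -
  have "frac R P (t' \<otimes> a' \<oplus> s' \<otimes> b') (s' \<otimes> t') = frac R P (t \<otimes> a \<oplus> s \<otimes> b) (s \<otimes> t)"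
    if k: "a' \<in> carrier R" "s' \<in> denominators" "b' \<in> carrier R" "t' \<in> denominators"
       "frac R P a' s' = frac R P a s" "frac R P b' t' = frac R P b t" for a' s' b' t'
  proof -
    obtain u where u: "u \<in> denominators" "u \<otimes> (s \<otimes> a') = u \<otimes> (s' \<otimes> a)"
      using k(5) frac_eq_iff[OF k(1,2) h(1,2)] by auto
    obtain v where v: "v \<in> denominators" "v \<otimes> (t \<otimes> b') = v \<otimes> (t' \<otimes> b)"
      using k(6) frac_eq_iff[OF k(3,4) h(3,4)] by auto
    have "(u \<otimes> v) \<otimes> ((s \<otimes> t) \<otimes> (t' \<otimes> a' \<oplus> s' \<otimes> b')) =
        (v \<otimes> t \<otimes> t') \<otimes> (u \<otimes> (s \<otimes> a')) \<oplus> (u \<otimes> s \<otimes> s') \<otimes> (v \<otimes> (t \<otimes> b'))"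
      using h k(1-4) u(1) v(1) by (simp add: r_distr m_ac)
    also have "\<dots> = (u \<otimes> v) \<otimes> ((s' \<otimes> t') \<otimes> (t \<otimes> a \<oplus> s \<otimes> b))"
      unfolding u(2) v(2) using h k(1-4) u(1) v(1) by (simp add: r_distr m_ac)
    finally show ?thesis
      using h k(1-4) u(1) v(1) denominators_mult[OF u(1) v(1)] denominators_mult[OF h(2,4)]
        denominators_mult[OF k(2,4)]
      by (intro iffD2[OF frac_eq_iff]) auto
  qed
  then show ?thesis
    unfolding localization_def by (simp, intro UN_frac_const[OF h]) auto
qed

lemma one_L: "\<one>\<^bsub>L\<^esub> = frac R P \<one> \<one>" and zero_L: "\<zero>\<^bsub>L\<^esub> = frac R P \<zero> \<one>"
  unfolding localization_def by auto

lemma cring_L: "cring L"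
proof (rule cringI)
  note [simp] = frac_mult frac_add one_L zero_L frac_closed one_denominator denominators_mult
  note [simp del] = Diff_iff
  have [simp]: "s \<in> carrier R" if "s \<in> denominators" for s using that by (simp add: Diff_iff)
  show "abelian_group L"
  proof (rule abelian_groupI)
    fix x y z assume "x \<in> carrier L" "y \<in> carrier L" "z \<in> carrier L"
    then show "x \<oplus>\<^bsub>L\<^esub> y \<oplus>\<^bsub>L\<^esub> z = x \<oplus>\<^bsub>L\<^esub> (y \<oplus>\<^bsub>L\<^esub> z)"
      by (elim frac_cases) (simp, intro frac_eqI, simp_all add: l_distr r_distr a_ac m_ac l_neg r_neg r_minus)
  next
    fix x assume "x \<in> carrier L"
    then obtain a s where x: "a \<in> carrier R" "s \<in> denominators" "s \<in> carrier R" "x = frac R P a s"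
      by (rule frac_cases)
    have "frac R P (s \<otimes> (\<ominus> a) \<oplus> s \<otimes> a) (s \<otimes> s) = frac R P \<zero> \<one>"
      using x by (intro frac_eqI) (simp_all add: l_distr r_distr a_ac m_ac l_neg r_neg r_minus)
    then show "\<exists>y\<in>carrier L. y \<oplus>\<^bsub>L\<^esub> x = \<zero>\<^bsub>L\<^esub>"
      using x by (intro bexI[of _ "frac R P (\<ominus> a) s"]) simp_all
  next
    fix x y assume "x \<in> carrier L" "y \<in> carrier L"
    then show "x \<oplus>\<^bsub>L\<^esub> y = y \<oplus>\<^bsub>L\<^esub> x"
      by (elim frac_cases) (simp, intro frac_eqI, simp_all add: l_distr r_distr a_ac m_ac l_neg r_neg r_minus)
  next
    fix x y assume "x \<in> carrier L" "y \<in> carrier L"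
    then show "x \<oplus>\<^bsub>L\<^esub> y \<in> carrier L" by (elim frac_cases) simp
  next
    show "\<zero>\<^bsub>L\<^esub> \<in> carrier L" by simp
  next
    fix x assume "x \<in> carrier L"
    then show "\<zero>\<^bsub>L\<^esub> \<oplus>\<^bsub>L\<^esub> x = x" by (elim frac_cases) simp
  qed
  show "comm_monoid L"
  proof (rule comm_monoidI)
    fix x y assume "x \<in> carrier L" "y \<in> carrier L"
    then show "x \<otimes>\<^bsub>L\<^esub> y \<in> carrier L" by (elim frac_cases) simp
  next
    show "\<one>\<^bsub>L\<^esub> \<in> carrier L" by simp
  next
    fix x y z assume "x \<in> carrier L" "y \<in> carrier L" "z \<in> carrier L"
    then show "x \<otimes>\<^bsub>L\<^esub> y \<otimes>\<^bsub>L\<^esub> z = x \<otimes>\<^bsub>L\<^esub> (y \<otimes>\<^bsub>L\<^esub> z)"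
      by (elim frac_cases) (simp add: m_assoc)
  next
    fix x assume "x \<in> carrier L"
    then show "\<one>\<^bsub>L\<^esub> \<otimes>\<^bsub>L\<^esub> x = x" by (elim frac_cases) simp
  next
    fix x y assume "x \<in> carrier L" "y \<in> carrier L"
    then show "x \<otimes>\<^bsub>L\<^esub> y = y \<otimes>\<^bsub>L\<^esub> x"
      by (elim frac_cases) (simp add: m_comm)
  qed
  fix x y z assume "x \<in> carrier L" "y \<in> carrier L" "z \<in> carrier L"
  then show "(x \<oplus>\<^bsub>L\<^esub> y) \<otimes>\<^bsub>L\<^esub> z = x \<otimes>\<^bsub>L\<^esub> z \<oplus>\<^bsub>L\<^esub> y \<otimes>\<^bsub>L\<^esub> z"
    by (elim frac_cases) (simp, intro frac_eqI, simp_all add: l_distr r_distr a_ac m_ac l_neg r_neg r_minus)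
qed

sublocale L: cring L by (rule cring_L)

sublocale \<rho>: ring_hom_cring R L \<rho>
proof (rule ring_hom_cringI[OF _ _ ring_hom_memI])
  note [simp] = frac_mult frac_add one_L zero_L frac_closed one_denominator denominators_mult
  note [simp del] = Diff_iff
  show "cring R" "cring L" by unfold_locales
  show "\<rho> \<one> = \<one>\<^bsub>L\<^esub>" by (simp add: \<rho>_def)
  fix x y assume "x \<in> carrier R" "y \<in> carrier R"
  then show "\<rho> x \<in> carrier L" "\<rho> (x \<otimes> y) = \<rho> x \<otimes>\<^bsub>L\<^esub> \<rho> y" "\<rho> (x \<oplus> y) = \<rho> x \<oplus>\<^bsub>L\<^esub> \<rho> y"
    by (auto simp: \<rho>_def)
qed

lemma rho_eq_zero_iff:
  assumes "a \<in> carrier R"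
  shows "\<rho> a = \<zero>\<^bsub>L\<^esub> \<longleftrightarrow> (\<exists>u \<in> denominators. u \<otimes> a = \<zero>)"
  using assms one_denominator unfolding \<rho>_def zero_L
  by (subst frac_eq_iff) auto

lemma rho_eq_iff:
  assumes "a \<in> carrier R" "b \<in> carrier R"
  shows "\<rho> a = \<rho> b \<longleftrightarrow> (\<exists>u \<in> denominators. u \<otimes> a = u \<otimes> b)"
  using assms one_denominator unfolding \<rho>_def by (subst frac_eq_iff) auto

lemma rho_denominator_Unit: "s \<in> denominators \<Longrightarrow> \<rho> s \<in> Units L"
proof -
  assume s: "s \<in> denominators"
  have "frac R P (s \<otimes> \<one>) (\<one> \<otimes> s) = frac R P \<one> \<one>"
    by (rule frac_eqI) (use s one_denominator in auto)
  then have "\<rho> s \<otimes>\<^bsub>L\<^esub> frac R P \<one> s = \<one>\<^bsub>L\<^esub>"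
    using s one_denominator frac_mult[of s \<one> \<one> s] unfolding \<rho>_def one_L by simp
  then show ?thesis
    using s frac_closed[of \<one> s] L.m_comm[of "\<rho> s" "frac R P \<one> s"]
    unfolding Units_def by auto
qed

lemma frac_mult_denominator:
  assumes "a \<in> carrier R" "s \<in> denominators"
  shows "frac R P a s \<otimes>\<^bsub>L\<^esub> \<rho> s = \<rho> a"
proof -
  have "frac R P (a \<otimes> s) (s \<otimes> \<one>) = frac R P a \<one>"
    by (rule frac_eqI) (use assms one_denominator in \<open>auto simp: m_comm\<close>)
  then show ?thesis
    using assms one_denominator frac_mult[of a s s \<one>] unfolding \<rho>_def by simp
qed

lemma fraction_cases:
  assumes "x \<in> carrier L"
  obtains a s where "a \<in> carrier R" "s \<in> denominators" "x \<otimes>\<^bsub>L\<^esub> \<rho> s = \<rho> a"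
proof -
  obtain a s where x: "a \<in> carrier R" "s \<in> denominators" "s \<in> carrier R" "x = frac R P a s"
    using assms by (rule frac_cases)
  then show ?thesis using that frac_mult_denominator by blast
qed

lemma fraction_exists:
  assumes "a \<in> carrier R" "s \<in> denominators"
  obtains x where "x \<in> carrier L" "x \<otimes>\<^bsub>L\<^esub> \<rho> s = \<rho> a"
  by (rule that[OF frac_closed[OF assms] frac_mult_denominator[OF assms]])

lemma cancel_rho:
  assumes "s \<in> denominators" "x \<in> carrier L" "y \<in> carrier L" "x \<otimes>\<^bsub>L\<^esub> \<rho> s = y \<otimes>\<^bsub>L\<^esub> \<rho> s"
  shows "x = y"
  using rho_denominator_Unit[OF assms(1)] assms(2-4) L.m_comm[of _ "\<rho> s"]
  by (metis L.Units_closed L.Units_l_cancel)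

lemma rho_in_Units_iff:
  assumes a: "a \<in> carrier R"
  shows "\<rho> a \<in> Units L \<longleftrightarrow> a \<notin> P"
proof
  assume "\<rho> a \<in> Units L"
  then obtain y where y: "y \<in> carrier L" "\<rho> a \<otimes>\<^bsub>L\<^esub> y = \<one>\<^bsub>L\<^esub>"
    by (meson L.Units_r_inv_ex)
  obtain b t where b: "b \<in> carrier R" "t \<in> denominators" "y \<otimes>\<^bsub>L\<^esub> \<rho> t = \<rho> b"
    using fraction_cases[OF y(1)] .
  have "\<rho> (a \<otimes> b) = \<rho> a \<otimes>\<^bsub>L\<^esub> (y \<otimes>\<^bsub>L\<^esub> \<rho> t)" using a b by simp
  also have "\<dots> = (\<rho> a \<otimes>\<^bsub>L\<^esub> y) \<otimes>\<^bsub>L\<^esub> \<rho> t" using a b y(1) by (simp add: L.m_assoc)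
  also have "\<dots> = \<rho> t" unfolding y(2) using b by simp
  finally obtain u where u: "u \<in> denominators" "u \<otimes> (a \<otimes> b) = u \<otimes> t"
    using rho_eq_iff[of "a \<otimes> b" t] a b by auto
  show "a \<notin> P"
  proof
    assume "a \<in> P"
    then have "a \<otimes> b \<in> P" using I_r_closed b by blast
    then have "u \<otimes> (a \<otimes> b) \<in> P" using I_l_closed u by blast
    then show False using denominators_mult[OF u(1) b(2)] u by auto
  qed
next
  assume "a \<notin> P"
  then show "\<rho> a \<in> Units L" using rho_denominator_Unit a by auto
qed

text \<open>A fraction is a unit exactly if its numerator lies outside \<open>P\<close>. Hence the nonunits form an
  ideal. Every proper ideal consists of nonunits, so this one is maximal and there is no other.\<close>

lemma maximalideal_L: "maximalideal M L \<longleftrightarrow> M = carrier L - Units L"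
proof -
  have Unit_iff: "x \<in> Units L \<longleftrightarrow> a \<notin> P"
    if "x \<in> carrier L" "a \<in> carrier R" "s \<in> denominators" "x \<otimes>\<^bsub>L\<^esub> \<rho> s = \<rho> a" for x a s
    using that rho_in_Units_iff[OF that(2)] rho_denominator_Unit[OF that(3)]
      L.unit_factor[of x "\<rho> s"] by (metis L.Units_m_closed \<rho>.hom_closed DiffD1)
  have ideal: "ideal (carrier L - Units L) L"
  proof (rule L.idealI_closed)
    show "\<zero>\<^bsub>L\<^esub> \<in> carrier L - Units L"
      using rho_in_Units_iff[of \<zero>] additive_subgroup.zero_closed[OF is_additive_subgroup] by simp
  next
    fix x y assume x: "x \<in> carrier L - Units L" and y: "y \<in> carrier L - Units L"
    obtain a s where a: "a \<in> carrier R" "s \<in> denominators" "x \<otimes>\<^bsub>L\<^esub> \<rho> s = \<rho> a"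
      using fraction_cases x by blast
    obtain b t where b: "b \<in> carrier R" "t \<in> denominators" "y \<otimes>\<^bsub>L\<^esub> \<rho> t = \<rho> b"
      using fraction_cases y by blast
    have "a \<in> P" "b \<in> P" using Unit_iff a b x y by blast+
    then have P: "a \<otimes> t \<oplus> b \<otimes> s \<in> P"
      using additive_subgroup.a_closed[OF is_additive_subgroup] I_r_closed a b by auto
    have "(x \<oplus>\<^bsub>L\<^esub> y) \<otimes>\<^bsub>L\<^esub> \<rho> (s \<otimes> t) = (x \<otimes>\<^bsub>L\<^esub> \<rho> s) \<otimes>\<^bsub>L\<^esub> \<rho> t \<oplus>\<^bsub>L\<^esub> (y \<otimes>\<^bsub>L\<^esub> \<rho> t) \<otimes>\<^bsub>L\<^esub> \<rho> s"
      using x y a(1,2) b(1,2) by (simp add: L.l_distr L.r_distr L.m_ac)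
    also have "\<dots> = \<rho> (a \<otimes> t \<oplus> b \<otimes> s)" unfolding a(3) b(3) using a(1,2) b(1,2) by simp
    finally show "x \<oplus>\<^bsub>L\<^esub> y \<in> carrier L - Units L"
      using Unit_iff[of "x \<oplus>\<^bsub>L\<^esub> y" "a \<otimes> t \<oplus> b \<otimes> s" "s \<otimes> t"] P x y a b denominators_mult by auto
  next
    fix r x assume "r \<in> carrier L" "x \<in> carrier L - Units L"
    then show "r \<otimes>\<^bsub>L\<^esub> x \<in> carrier L - Units L" "x \<otimes>\<^bsub>L\<^esub> r \<in> carrier L - Units L"
      using L.unit_factor[of x r] L.m_comm[of r x] by auto
  qed auto
  have proper: "J \<subseteq> carrier L - Units L" if J: "ideal J L" "J \<noteq> carrier L" for J
  proof -
    have False if "x \<in> J" "x \<in> Units L" for x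
    proof -
      have "inv\<^bsub>L\<^esub> x \<otimes>\<^bsub>L\<^esub> x \<in> J" using ideal.I_l_closed[OF J(1)] that L.Units_inv_closed by blast
      then show False using ideal.one_imp_carrier[OF J(1)] J(2) that by simp
    qed
    then show ?thesis using ideal.Icarr[OF J(1)] by auto
  qed
  have max: "maximalideal (carrier L - Units L) L"
  proof (rule maximalidealI[OF ideal])
    show "carrier L \<noteq> carrier L - Units L" using L.Units_one_closed by auto
    show "J = carrier L - Units L \<or> J = carrier L"
      if "ideal J L" "carrier L - Units L \<subseteq> J" "J \<subseteq> carrier L" for J
      using proper that by blast
  qed
  show ?thesis
  proof
    assume M: "maximalideal M L"
    then have "M \<subseteq> carrier L - Units L"
      using proper maximalideal.axioms(1) maximalideal.I_notcarr by metis
    then show "M = carrier L - Units L"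
      using maximalideal.I_maximal[OF M ideal] L.Units_one_closed by auto
  qed (use max in simp)
qed

lemma the_maximalideal_L: "(THE M. maximalideal M L) = carrier L - Units L"
  using maximalideal_L by auto

lemma nonunit_cases:
  assumes "x \<in> carrier L - Units L"
  obtains a s where "a \<in> P" "s \<in> denominators" "x \<otimes>\<^bsub>L\<^esub> \<rho> s = \<rho> a"
proof -
  obtain a s where a: "a \<in> carrier R" "s \<in> denominators" "x \<otimes>\<^bsub>L\<^esub> \<rho> s = \<rho> a"
    using fraction_cases assms by blast
  have "a \<in> P"
  proof (rule ccontr)
    assume "a \<notin> P"
    then have "x \<otimes>\<^bsub>L\<^esub> \<rho> s \<in> Units L" using a rho_in_Units_iff by simp
    then show False using assms a L.unit_factor[of x "\<rho> s"] by auto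
  qed
  then show ?thesis using that a by blast
qed

end

section \<open>The Zariski topology and codimension\<close>

lemma topspace_zariski:
  assumes "ring R"
  shows "topspace (zariski R) = Spec R"
proof -
  interpret ring R by fact
  have "\<one>\<^bsub>R\<^esub> \<notin> P" if "primeideal P R" for P
    using primeideal.I_notcarr[OF that] ideal.one_imp_carrier[OF primeideal.axioms(1)[OF that]] by auto
  then have "Spec R = {P \<in> Spec R. \<one>\<^bsub>R\<^esub> \<notin> P}" unfolding Spec_def by auto
  then have "Spec R \<in> {{P \<in> Spec R. f \<notin> P} | f. f \<in> carrier R}"
    by (intro CollectI exI[of _ "\<one>\<^bsub>R\<^esub>"]) simp
  then show ?thesis
    unfolding zariski_def topology_generated_by_topspace by auto
qed

text \<open>It suffices to check this on the basic open sets, where it is plain: if \<open>f\<close> is not in \<open>P'\<close>, it is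
  not in the smaller \<open>P\<close> either.\<close>

lemma zariski_open_generization:
  assumes "openin (zariski R) V" and "P' \<in> V" and "P \<in> Spec R" and "P \<subseteq> P'"
  shows "P \<in> V"
proof -
  have "generate_topology_on {{P \<in> Spec R. f \<notin> P} | f. f \<in> carrier R} V"
    using assms(1) unfolding zariski_def openin_topology_generated_by_iff .
  then show ?thesis using assms(2-4)
    by induction auto
qed

lemma zariski_closure_of_point:
  assumes R: "ring R" and P: "P \<in> Spec R"
  shows "zariski R closure_of {P} = {Q \<in> Spec R. P \<subseteq> Q}"
proof (intro Set.equalityI subsetI)
  fix Q assume Q: "Q \<in> zariski R closure_of {P}"
  then have near: "P \<in> V" if "Q \<in> V" "openin (zariski R) V" for V
    using that unfolding in_closure_of by simp
  have "f \<in> Q" if "f \<in> P" for f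
  proof (rule ccontr)
    assume f: "f \<notin> Q"
    have "f \<in> carrier R"
      using that P ideal.Icarr[OF primeideal.axioms(1)] unfolding Spec_def by auto
    then have "openin (zariski R) {P \<in> Spec R. f \<notin> P}"
      unfolding zariski_def by (intro topology_generated_by_Basis) auto
    moreover have "Q \<in> Spec R"
      using Q unfolding in_closure_of topspace_zariski[OF R] by simp
    then have "Q \<in> {P \<in> Spec R. f \<notin> P}" using f by simp
    ultimately have "P \<in> {P \<in> Spec R. f \<notin> P}"
      using near by metis
    then show False using that by simp
  qed
  then show "Q \<in> {Q \<in> Spec R. P \<subseteq> Q}"
    using Q unfolding in_closure_of topspace_zariski[OF R] by auto
next
  fix Q assume "Q \<in> {Q \<in> Spec R. P \<subseteq> Q}"
  then show "Q \<in> zariski R closure_of {P}"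
    using zariski_open_generization[OF _ _ P, of _ Q]
    unfolding in_closure_of topspace_zariski[OF R] by simp
qed

lemma generic_point_closure:
  assumes R: "ring R" and P: "P \<in> Spec R"
  shows "generic_point R {Q \<in> Spec R. P \<subseteq> Q} = P"
  unfolding generic_point_def
proof (rule the_equality)
  show "P \<in> Spec R \<and> zariski R closure_of {P} = {Q \<in> Spec R. P \<subseteq> Q}"
    using zariski_closure_of_point[OF R P] P by simp
next
  fix P' assume P': "P' \<in> Spec R \<and> zariski R closure_of {P'} = {Q \<in> Spec R. P \<subseteq> Q}"
  then have eq: "{Q \<in> Spec R. P' \<subseteq> Q} = {Q \<in> Spec R. P \<subseteq> Q}"
    using zariski_closure_of_point[OF R] by auto
  from eq[unfolded set_eq_iff, rule_format, of P] eq[unfolded set_eq_iff, rule_format, of P']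
  show "P' = P" using P P' by blast
qed

lemma irreducible_closed_closure:
  assumes R: "ring R" and P: "P \<in> Spec R"
  shows "irreducible_closed (zariski R) {Q \<in> Spec R. P \<subseteq> Q}"
proof -
  let ?V = "zariski R closure_of {P}"
  have top: "P \<in> topspace (zariski R)" using P topspace_zariski[OF R] by simp
  have "?V \<subseteq> C" if "closedin (zariski R) C" "P \<in> C" for C
    using closure_of_minimal[of "{P}" C] that by simp
  moreover have "P \<in> ?V" using closure_of_subset[of "{P}" "zariski R"] top by simp
  ultimately have "irreducible_closed (zariski R) ?V"
    unfolding irreducible_closed_def irreducible_in_def
    by (auto simp: closure_of_subset_topspace)
  then show ?thesis unfolding zariski_closure_of_point[OF R P] .
qed

lemma codim_antimono: "Y \<subseteq> Z \<Longrightarrow> codim T Z \<le> codim T Y"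
  unfolding codim_def by (rule Inf_superset_mono) auto

lemma codim_topspace_eq_0:
  assumes "irreducible_closed T (topspace T)"
  shows "codim T (topspace T) = 0"
proof -
  have "codim T (topspace T) \<le> codim_irreducible T (topspace T)"
    unfolding codim_def by (rule Inf_lower) (use assms in auto)
  also have "\<dots> \<le> 0"
    unfolding codim_irreducible_def
  proof (rule Sup_least, clarify)
    fix n and c :: "nat \<Rightarrow> 'a set"
    assume c: "c 0 = topspace T" "\<forall>i\<le>n. irreducible_closed T (c i)" "\<forall>i<n. c i \<subset> c (Suc i)"
    have "\<not> 0 < n"
    proof
      assume "0 < n"
      then have "irreducible_closed T (c 1)" "c 0 \<subset> c 1" using c by auto
      then show False
        unfolding irreducible_closed_def using c(1) closedin_subset by blast
    qed
    then show "enat n \<le> 0" by (simp add: zero_enat_def)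
  qed
  finally show ?thesis by simp
qed

text \<open>Every irreducible closed subset of \<open>Z\<close> is the lower end of a chain of length one that ends in the
  whole space.\<close>

lemma one_le_codim:
  assumes top: "irreducible_closed T (topspace T)" and Z: "Z \<subset> topspace T"
  shows "1 \<le> codim T Z"
  unfolding codim_def
proof (rule Inf_greatest, clarify)
  fix Y assume Y: "irreducible_closed T Y" "Y \<subseteq> Z"
  then have "Y \<subset> topspace T" using Z by auto
  let ?c = "\<lambda>i::nat. if i = 0 then Y else topspace T"
  have "enat 1 \<le> codim_irreducible T Y"
    unfolding codim_irreducible_def
    by (rule Sup_upper, intro CollectI exI[of _ 1] conjI refl exI[of _ ?c]) (use Y(1) top \<open>Y \<subset> topspace T\<close> in simp_all)
  then show "1 \<le> codim_irreducible T Y" by (simp add: one_enat_def)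
qed

text \<open>Serre's condition read off at a prime: the closed set with generic point \<open>Q\<close> consists of the
  primes containing \<open>Q\<close>.\<close>

lemma serre_S_depth:
  assumes R: "ring R" and "serre_S i R" and Q: "Q \<in> Spec R" and "k \<le> i"
    and "enat k \<le> codim (zariski R) {Q' \<in> Spec R. Q \<subseteq> Q'}"
  shows "enat k \<le> depth (localization R Q)"
proof -
  have "enat k \<le> min (enat i) (codim (zariski R) {Q' \<in> Spec R. Q \<subseteq> Q'})"
    using assms by simp
  also have "\<dots> \<le> depth (localization R Q)"
    using assms(2) irreducible_closed_closure[OF R Q] generic_point_closure[OF R Q]
    unfolding serre_S_def by metis
  finally show ?thesis .
qed

section \<open>Depth one and depth two\<close>

lemma depth_ge_SucE:
  assumes "enat (Suc n) \<le> depth R"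
  obtains xs where "regular_sequence R xs" "set xs \<subseteq> (THE M. maximalideal M R)" "Suc n \<le> length xs"
proof (rule ccontr)
  assume *: "\<not> thesis"
  have "depth R \<le> enat n"
    unfolding depth_def
  proof (rule Sup_least, clarify)
    fix xs :: "'a list"
    assume "regular_sequence R xs" "set xs \<subseteq> (THE M. maximalideal M R)"
    then show "enat (length xs) \<le> enat n" using * that[of xs] by fastforce
  qed
  then show False using assms by (metis Suc_n_not_le_n enat_ord_simps(1) order_trans)
qed

context cring
begin

lemma genideal_empty: "genideal R {} = {\<zero>}"
  using genideal_minimal[OF zeroideal, of "{}"]
    additive_subgroup.zero_closed[OF ideal.axioms(1)[OF genideal_ideal[of "{}"]]]
  by auto

lemma regular_sequence_first:
  assumes "regular_sequence R xs" and "1 \<le> length xs" and "a \<in> carrier R" and "xs ! 0 \<otimes> a = \<zero>"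
  shows "a = \<zero>"
proof -
  have "\<forall>a \<in> carrier R. xs ! 0 \<otimes> a \<in> genideal R {} \<longrightarrow> a \<in> genideal R {}"
    using assms(1,2) unfolding regular_sequence_def by (metis One_nat_def Suc_le_eq take0 set_empty)
  then show ?thesis using assms(3,4) unfolding genideal_empty by simp
qed

lemma regular_sequence_second:
  assumes reg: "regular_sequence R xs" and len: "2 \<le> length xs"
    and a: "a \<in> carrier R" and b: "b \<in> carrier R" and eq: "xs ! 1 \<otimes> a = b \<otimes> xs ! 0"
  shows "\<exists>r \<in> carrier R. a = r \<otimes> xs ! 0"
proof -
  have "xs ! 0 \<in> set xs" using len by (intro nth_mem) auto
  then have x: "xs ! 0 \<in> carrier R" using reg unfolding regular_sequence_def by blast
  have take: "take 1 xs = [xs ! 0]"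
    using len by (cases xs) auto
  have gen: "genideal R {xs ! 0} = {r \<otimes> xs ! 0 | r. r \<in> carrier R}"
    using cgenideal_eq_genideal[OF x] unfolding cgenideal_def by auto
  have "xs ! 1 \<otimes> a \<in> genideal R {xs ! 0}" unfolding gen eq using b by auto
  moreover have "\<forall>a \<in> carrier R.
        xs ! 1 \<otimes> a \<in> genideal R (set (take 1 xs)) \<longrightarrow> a \<in> genideal R (set (take 1 xs))"
    using reg len unfolding regular_sequence_def by auto
  ultimately have "a \<in> genideal R {xs ! 0}" using a unfolding take by simp
  then show ?thesis unfolding gen by auto
qed

lemma regular_mult_cancel:
  assumes "a \<in> carrier R" "b \<in> carrier R" "c \<in> carrier R" "c \<otimes> a = c \<otimes> b"
    and nzd: "\<And>z. z \<in> carrier R \<Longrightarrow> c \<otimes> z = \<zero> \<Longrightarrow> z = \<zero>"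
  shows "a = b"
proof -
  have "c \<otimes> (a \<ominus> b) = c \<otimes> a \<ominus> c \<otimes> b"
    using assms(1-3) by (simp add: minus_eq r_distr r_minus)
  then have "c \<otimes> (a \<ominus> b) = \<zero>" using assms(1-4) by (simp add: r_right_minus_eq)
  then have "a \<ominus> b = \<zero>" using nzd assms(1,2) by simp
  then show ?thesis using assms(1,2) by (simp add: r_right_minus_eq)
qed

text \<open>Let \<open>x, y\<close> begin the regular sequence, and write \<open>x w = s v\<close> and \<open>y w = s v'\<close>. Then \<open>s y v = s x v'\<close>,
  so \<open>y v = x v'\<close> as \<open>s\<close> is not a zero divisor. Regularity of \<open>y\<close> modulo \<open>x\<close> gives \<open>v = x r\<close>, and
  cancelling \<open>x\<close> in \<open>x w = s x r\<close> leaves \<open>w = s r\<close>. In other words, depth two of a local ring excludes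
  the maximal ideal from the associated primes of \<open>s\<close>.\<close>

lemma dvd_if_regular_multiples_dvd:
  assumes reg: "regular_sequence R xs" and len: "2 \<le> length xs"
    and s: "s \<in> carrier R" and nzd: "\<And>z. z \<in> carrier R \<Longrightarrow> s \<otimes> z = \<zero> \<Longrightarrow> z = \<zero>"
    and w: "w \<in> carrier R" and mult: "\<And>x. x \<in> set xs \<Longrightarrow> \<exists>v \<in> carrier R. x \<otimes> w = s \<otimes> v"
  shows "\<exists>r \<in> carrier R. w = s \<otimes> r"
proof -
  define x y where "x = xs ! 0" and "y = xs ! 1"
  have mem: "x \<in> set xs" "y \<in> set xs"
    unfolding x_def y_def using len by (auto intro!: nth_mem)
  then have xy: "x \<in> carrier R" "y \<in> carrier R" using reg unfolding regular_sequence_def by auto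
  obtain v where v: "v \<in> carrier R" "x \<otimes> w = s \<otimes> v" using mult mem by blast
  obtain v' where v': "v' \<in> carrier R" "y \<otimes> w = s \<otimes> v'" using mult mem by blast
  have "s \<otimes> (y \<otimes> v) = y \<otimes> (s \<otimes> v)" using s v(1) xy by (simp add: m_ac)
  also have "\<dots> = y \<otimes> (x \<otimes> w)" unfolding v(2) ..
  also have "\<dots> = x \<otimes> (y \<otimes> w)" using w xy by (simp add: m_ac)
  also have "\<dots> = s \<otimes> (v' \<otimes> x)" unfolding v'(2) using s v'(1) xy by (simp add: m_ac)
  finally have "s \<otimes> (y \<otimes> v) = s \<otimes> (v' \<otimes> x)" .
  then have "y \<otimes> v = v' \<otimes> x"
    using v(1) v'(1) xy by (elim regular_mult_cancel[OF _ _ s _ nzd, rotated 2]) simp_all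
  then obtain r where r: "r \<in> carrier R" "v = r \<otimes> x"
    using regular_sequence_second[OF reg len v(1) v'(1)] unfolding x_def y_def by auto
  have eq: "x \<otimes> w = x \<otimes> (s \<otimes> r)" unfolding v(2) r(2) using s r(1) xy by (simp add: m_ac)
  have "w = s \<otimes> r"
  proof (rule regular_mult_cancel[OF w _ xy(1) eq])
    show "z = \<zero>" if "z \<in> carrier R" "x \<otimes> z = \<zero>" for z
      using regular_sequence_first[OF reg _ that(1)] that(2) len by (simp add: x_def)
  qed (use s r(1) in simp)
  then show ?thesis using r by auto
qed

end

context localization_at_prime
begin

text \<open>The maximal ideal of the localization annihilates the image of \<open>w\<close>; as it contains a regular
  element, that image is zero.\<close>

lemma depth_ge_1_annihilator:
  assumes depth: "1 \<le> depth L" and w: "w \<in> carrier R" and ann: "\<And>q. q \<in> P \<Longrightarrow> q \<otimes> w = \<zero>"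
  shows "\<exists>u \<in> denominators. u \<otimes> w = \<zero>"
proof -
  have "enat (Suc 0) \<le> depth L" using depth by (simp add: one_enat_def)
  then obtain xs where xs: "regular_sequence L xs" "set xs \<subseteq> (THE M. maximalideal M L)" "1 \<le> length xs"
    by (rule depth_ge_SucE) auto
  have "xs ! 0 \<in> set xs" using xs(3) by (intro nth_mem) auto
  then have x: "xs ! 0 \<in> carrier L - Units L" using xs(2) unfolding the_maximalideal_L by blast
  then obtain a s where a: "a \<in> P" "s \<in> denominators" "xs ! 0 \<otimes>\<^bsub>L\<^esub> \<rho> s = \<rho> a"
    by (rule nonunit_cases)
  have sR: "s \<in> carrier R" and aR: "a \<in> carrier R" using a Icarr by auto
  have "xs ! 0 \<otimes>\<^bsub>L\<^esub> (\<rho> s \<otimes>\<^bsub>L\<^esub> \<rho> w) = (xs ! 0 \<otimes>\<^bsub>L\<^esub> \<rho> s) \<otimes>\<^bsub>L\<^esub> \<rho> w"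
    using x sR w by (simp add: L.m_assoc)
  also have "\<dots> = \<rho> (a \<otimes> w)" unfolding a(3) using aR w by simp
  also have "\<dots> = \<zero>\<^bsub>L\<^esub>" using ann[OF a(1)] by simp
  finally have "\<rho> (s \<otimes> w) = \<zero>\<^bsub>L\<^esub>"
    using L.regular_sequence_first[OF xs(1,3)] sR w by simp
  then obtain u where "u \<in> denominators" "u \<otimes> (s \<otimes> w) = \<zero>"
    using rho_eq_zero_iff[of "s \<otimes> w"] sR w by auto
  then show ?thesis using denominators_mult a(2) sR w by (intro bexI[of _ "u \<otimes> s"]) (auto simp: m_assoc)
qed

text \<open>The numerators of elements of the maximal ideal lie in \<open>P\<close>, so the divisibility hypothesis
  passes to the localization, where the lemma on regular pairs applies. Clearing denominators gives
  the conclusion.\<close>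

lemma depth_ge_2_colon:
  assumes depth: "2 \<le> depth L"
    and s: "s \<in> carrier R" and nzd: "\<And>z. z \<in> carrier R \<Longrightarrow> s \<otimes> z = \<zero> \<Longrightarrow> z = \<zero>"
    and w: "w \<in> carrier R" and mult: "\<And>q. q \<in> P \<Longrightarrow> \<exists>v \<in> carrier R. q \<otimes> w = s \<otimes> v"
  shows "\<exists>u \<in> denominators. \<exists>r \<in> carrier R. u \<otimes> w = s \<otimes> r"
proof -
  have "enat (Suc 1) \<le> depth L" using depth by (simp add: numeral_eq_enat numeral_2_eq_2)
  then obtain xs where xs: "regular_sequence L xs" "set xs \<subseteq> (THE M. maximalideal M L)" "2 \<le> length xs"
    by (rule depth_ge_SucE) auto
  have "\<exists>r \<in> carrier L. \<rho> w = \<rho> s \<otimes>\<^bsub>L\<^esub> r"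
  proof (rule L.dvd_if_regular_multiples_dvd[OF xs(1,3)])
    show "\<rho> s \<in> carrier L" "\<rho> w \<in> carrier L" using s w by auto
  next
    fix z assume z: "z \<in> carrier L" "\<rho> s \<otimes>\<^bsub>L\<^esub> z = \<zero>\<^bsub>L\<^esub>"
    obtain b t where b: "b \<in> carrier R" "t \<in> denominators" "z \<otimes>\<^bsub>L\<^esub> \<rho> t = \<rho> b"
      using fraction_cases[OF z(1)] .
    have tR: "t \<in> carrier R" using b by auto
    have "\<rho> (s \<otimes> b) = \<rho> s \<otimes>\<^bsub>L\<^esub> (z \<otimes>\<^bsub>L\<^esub> \<rho> t)" unfolding b(3) using s b(1) by simp
    also have "\<dots> = (\<rho> s \<otimes>\<^bsub>L\<^esub> z) \<otimes>\<^bsub>L\<^esub> \<rho> t" using s z(1) tR by (simp add: L.m_assoc)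
    also have "\<dots> = \<zero>\<^bsub>L\<^esub>" unfolding z(2) using tR by simp
    finally obtain u where u: "u \<in> denominators" "u \<otimes> (s \<otimes> b) = \<zero>"
      using rho_eq_zero_iff[of "s \<otimes> b"] s b(1) by auto
    have "s \<otimes> (u \<otimes> b) = \<zero>" using u s b(1) by (simp add: m_lcomm)
    then have "u \<otimes> b = \<zero>" using nzd u(1) b(1) by auto
    then have "\<rho> b = \<zero>\<^bsub>L\<^esub>" using rho_eq_zero_iff u b(1) by blast
    then have "z \<otimes>\<^bsub>L\<^esub> \<rho> t = \<zero>\<^bsub>L\<^esub> \<otimes>\<^bsub>L\<^esub> \<rho> t" using b(3) tR by simp
    then show "z = \<zero>\<^bsub>L\<^esub>" using cancel_rho[OF b(2) z(1)] by simp
  next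
    fix x assume "x \<in> set xs"
    then have x: "x \<in> carrier L - Units L" using xs(2) unfolding the_maximalideal_L by blast
    then obtain a t where a: "a \<in> P" "t \<in> denominators" "x \<otimes>\<^bsub>L\<^esub> \<rho> t = \<rho> a"
      by (rule nonunit_cases)
    have tR: "t \<in> carrier R" and aR: "a \<in> carrier R" using a Icarr by auto
    obtain v where v: "v \<in> carrier R" "a \<otimes> w = s \<otimes> v" using mult[OF a(1)] by auto
    obtain y where y: "y \<in> carrier L" "y \<otimes>\<^bsub>L\<^esub> \<rho> t = \<rho> v" using fraction_exists[OF v(1) a(2)] .
    have "(x \<otimes>\<^bsub>L\<^esub> \<rho> w) \<otimes>\<^bsub>L\<^esub> \<rho> t = (x \<otimes>\<^bsub>L\<^esub> \<rho> t) \<otimes>\<^bsub>L\<^esub> \<rho> w"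
      using x w tR by (simp add: L.m_ac)
    also have "\<dots> = \<rho> (a \<otimes> w)" unfolding a(3) using aR w by simp
    also have "\<dots> = \<rho> s \<otimes>\<^bsub>L\<^esub> (y \<otimes>\<^bsub>L\<^esub> \<rho> t)" unfolding v(2) y(2) using s v(1) by simp
    also have "\<dots> = (\<rho> s \<otimes>\<^bsub>L\<^esub> y) \<otimes>\<^bsub>L\<^esub> \<rho> t" using s y(1) tR by (simp add: L.m_assoc)
    finally have "x \<otimes>\<^bsub>L\<^esub> \<rho> w = \<rho> s \<otimes>\<^bsub>L\<^esub> y"
      using cancel_rho[OF a(2)] x w s y(1) by auto
    then show "\<exists>v\<in>carrier L. x \<otimes>\<^bsub>L\<^esub> \<rho> w = \<rho> s \<otimes>\<^bsub>L\<^esub> v" using y(1) by blast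
  qed
  then obtain r where r: "r \<in> carrier L" "\<rho> w = \<rho> s \<otimes>\<^bsub>L\<^esub> r" by auto
  obtain b t where b: "b \<in> carrier R" "t \<in> denominators" "r \<otimes>\<^bsub>L\<^esub> \<rho> t = \<rho> b"
    using fraction_cases[OF r(1)] .
  have tR: "t \<in> carrier R" using b by auto
  have "\<rho> (w \<otimes> t) = (\<rho> s \<otimes>\<^bsub>L\<^esub> r) \<otimes>\<^bsub>L\<^esub> \<rho> t" using w tR r(2) by simp
  also have "\<dots> = \<rho> s \<otimes>\<^bsub>L\<^esub> (r \<otimes>\<^bsub>L\<^esub> \<rho> t)" using s r(1) tR by (simp add: L.m_assoc)
  also have "\<dots> = \<rho> (s \<otimes> b)" unfolding b(3) using s b(1) by simp
  finally obtain u where u: "u \<in> denominators" "u \<otimes> (w \<otimes> t) = u \<otimes> (s \<otimes> b)"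
    using rho_eq_iff[of "w \<otimes> t" "s \<otimes> b"] w tR s b(1) by auto
  then have "(u \<otimes> t) \<otimes> w = s \<otimes> (u \<otimes> b)" using w s b(1) tR by (simp add: m_ac)
  then show ?thesis using denominators_mult[OF u(1) b(2)] u(1) b(1) by blast
qed

end

section \<open>Associated primes under Serre's condition\<close>

text \<open>Among the proper colon ideals \<open>(I : c w)\<close> there is a maximal one. It is prime: if \<open>b\<close> is not in it,
  then \<open>(I : b c w)\<close> is proper and contains it, hence equals it, and it contains every \<open>a\<close> for which
  \<open>a b\<close> is in the given one.\<close>

lemma noetherian_associated_prime:
  assumes "cring R" and "noetherian_ring R" and I: "ideal I R"
    and w: "w \<in> carrier R" "w \<notin> I"
  obtains c where "c \<in> carrier R" "primeideal {r \<in> carrier R. r \<otimes>\<^bsub>R\<^esub> (c \<otimes>\<^bsub>R\<^esub> w) \<in> I} R"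
proof -
  interpret cring R by fact
  interpret noetherian_ring R by fact
  let ?colon = "\<lambda>v. {r \<in> carrier R. r \<otimes>\<^bsub>R\<^esub> v \<in> I}"
  have colon_ideal: "ideal (?colon v) R" if "v \<in> carrier R" for v
  proof (rule idealI_closed)
    show "\<zero>\<^bsub>R\<^esub> \<in> ?colon v"
      using that additive_subgroup.zero_closed[OF ideal.axioms(1)[OF I]] by simp
  next
    fix x y assume "x \<in> ?colon v" "y \<in> ?colon v"
    then show "x \<oplus>\<^bsub>R\<^esub> y \<in> ?colon v"
      using that additive_subgroup.a_closed[OF ideal.axioms(1)[OF I]] by (simp add: l_distr)
  next
    fix r x assume *: "r \<in> carrier R" "x \<in> ?colon v"
    then show "r \<otimes>\<^bsub>R\<^esub> x \<in> ?colon v" using that ideal.I_l_closed[OF I] by (simp add: m_assoc)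
    with * show "x \<otimes>\<^bsub>R\<^esub> r \<in> ?colon v" using m_comm[of x r] by simp
  qed auto
  let ?\<I> = "{?colon (c \<otimes>\<^bsub>R\<^esub> w) | c. c \<in> carrier R \<and> c \<otimes>\<^bsub>R\<^esub> w \<notin> I}"
  have "?colon (\<one>\<^bsub>R\<^esub> \<otimes>\<^bsub>R\<^esub> w) \<in> ?\<I>" using w by (intro CollectI exI[of _ "\<one>\<^bsub>R\<^esub>"]) simp
  then have "?\<I> \<noteq> {}" by blast
  moreover have "ideal J R" if "J \<in> ?\<I>" for J using that w(1) colon_ideal by auto
  ultimately have "\<exists>M\<in>?\<I>. \<forall>J\<in>?\<I>. M \<subseteq> J \<longrightarrow> J = M" by (rule exists_maximal_ideal_in)
  then obtain M where "M \<in> ?\<I>" and max: "\<forall>J\<in>?\<I>. M \<subseteq> J \<longrightarrow> J = M" by (rule bexE)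
  then obtain c where c: "c \<in> carrier R" "c \<otimes>\<^bsub>R\<^esub> w \<notin> I" and M: "M = ?colon (c \<otimes>\<^bsub>R\<^esub> w)" by auto
  have "primeideal M R"
  proof (rule primeidealI)
    show "ideal M R" unfolding M using colon_ideal c w by simp
    show "cring R" by unfold_locales
    have "\<one>\<^bsub>R\<^esub> \<notin> M" unfolding M using c w by simp
    then show "carrier R \<noteq> M" by auto
  next
    fix a b assume ab: "a \<in> carrier R" "b \<in> carrier R" "a \<otimes>\<^bsub>R\<^esub> b \<in> M"
    show "a \<in> M \<or> b \<in> M"
    proof (rule disjCI)
      assume "b \<notin> M"
      then have "(b \<otimes>\<^bsub>R\<^esub> c) \<otimes>\<^bsub>R\<^esub> w \<notin> I" using ab(2) c w unfolding M by (simp add: m_assoc)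
      then have J: "?colon ((b \<otimes>\<^bsub>R\<^esub> c) \<otimes>\<^bsub>R\<^esub> w) \<in> ?\<I>" using ab(2) c(1) by blast
      have "M \<subseteq> ?colon ((b \<otimes>\<^bsub>R\<^esub> c) \<otimes>\<^bsub>R\<^esub> w)"
      proof
        fix r assume r: "r \<in> M"
        then have "r \<in> carrier R" "b \<otimes>\<^bsub>R\<^esub> (r \<otimes>\<^bsub>R\<^esub> (c \<otimes>\<^bsub>R\<^esub> w)) \<in> I"
          unfolding M using ideal.I_l_closed[OF I] ab(2) by auto
        then show "r \<in> ?colon ((b \<otimes>\<^bsub>R\<^esub> c) \<otimes>\<^bsub>R\<^esub> w)"
          using ab(2) c(1) w(1) by (simp add: m_ac)
      qed
      then have "?colon ((b \<otimes>\<^bsub>R\<^esub> c) \<otimes>\<^bsub>R\<^esub> w) = M" by (rule max[rule_format, OF J])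
      moreover have "a \<in> ?colon ((b \<otimes>\<^bsub>R\<^esub> c) \<otimes>\<^bsub>R\<^esub> w)"
        using ab c(1) w(1) unfolding M by (simp add: m_assoc)
      ultimately show "a \<in> M" by simp
    qed
  qed
  then show thesis using that c(1) unfolding M by blast
qed

text \<open>The coordinate rings of the irreducible Noetherian affine schemes with property \<open>(S\<^sub>2)\<close>. They may have
  nilpotent elements.\<close>

locale irreducible_S2_ring = cring R + noetherian_ring R for R (structure) +
  assumes irreducible: "irreducible_in (zariski R) (Spec R)"
    and S2: "serre_S 2 R"
begin

text \<open>The generic point of the spectrum.\<close>

definition generic :: "'a set" where "generic = \<Inter>(Spec R)"

lemma Spec_primeideal: "Q \<in> Spec R \<Longrightarrow> primeideal Q R"
  unfolding Spec_def by simp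

lemma Spec_carr: "Q \<in> Spec R \<Longrightarrow> a \<in> Q \<Longrightarrow> a \<in> carrier R"
  using ideal.Icarr[OF primeideal.axioms(1)[OF Spec_primeideal]] .

lemma Spec_nonempty: "Spec R \<noteq> {}"
  using irreducible unfolding irreducible_in_def by simp

lemma generic_subset: "Q \<in> Spec R \<Longrightarrow> generic \<subseteq> Q"
  unfolding generic_def by auto

lemma generic_prime: "primeideal generic R"
proof (rule primeidealI)
  have ideals: "ideal Q R" if "Q \<in> Spec R" for Q
    using primeideal.axioms(1)[OF Spec_primeideal[OF that]] .
  show "ideal generic R"
    unfolding generic_def by (rule i_Intersect[OF ideals Spec_nonempty])
  show "cring R" by unfold_locales
  obtain Q where Q: "Q \<in> Spec R" using Spec_nonempty by auto
  show "carrier R \<noteq> generic"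
    using generic_subset[OF Q] Spec_carr[OF Q] primeideal.I_notcarr[OF Spec_primeideal[OF Q]] by auto
next
  fix a b assume a: "a \<in> carrier R" and b: "b \<in> carrier R" and ab: "a \<otimes> b \<in> generic"
  have closed: "closedin (zariski R) {Q \<in> Spec R. f \<in> Q}" if "f \<in> carrier R" for f
  proof -
    have "openin (zariski R) {Q \<in> Spec R. f \<notin> Q}"
      unfolding zariski_def by (intro topology_generated_by_Basis) (use that in auto)
    moreover have "Spec R - {Q \<in> Spec R. f \<in> Q} = {Q \<in> Spec R. f \<notin> Q}" by auto
    ultimately show ?thesis unfolding closedin_def topspace_zariski[OF ring_axioms] by auto
  qed
  have "Spec R \<subseteq> {Q \<in> Spec R. a \<in> Q} \<union> {Q \<in> Spec R. b \<in> Q}"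
    using ab a b primeideal.I_prime[OF Spec_primeideal] unfolding generic_def by auto
  then have "Spec R \<subseteq> {Q \<in> Spec R. a \<in> Q} \<or> Spec R \<subseteq> {Q \<in> Spec R. b \<in> Q}"
    using irreducible closed[OF a] closed[OF b] unfolding irreducible_in_def by blast
  then show "a \<in> generic \<or> b \<in> generic" unfolding generic_def by auto
qed

lemma generic_Spec: "generic \<in> Spec R"
  using generic_prime unfolding Spec_def by simp

lemma irreducible_topspace: "irreducible_closed (zariski R) (topspace (zariski R))"
  using irreducible unfolding irreducible_closed_def topspace_zariski[OF ring_axioms, symmetric] by simp

text \<open>There are no embedded primes: a prime other than the generic one has codimension at least one,
  hence depth at least one, and so cannot be the annihilator of an element.\<close>

lemma annihilator_prime_eq_generic:
  assumes w: "w \<in> carrier R" and Q: "{r \<in> carrier R. r \<otimes> w = \<zero>} \<in> Spec R"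
  shows "{r \<in> carrier R. r \<otimes> w = \<zero>} = generic"
proof (rule ccontr)
  let ?Q = "{r \<in> carrier R. r \<otimes> w = \<zero>}"
  assume ne: "?Q \<noteq> generic"
  have loc: "localization_at_prime R ?Q"
    using Spec_primeideal[OF Q] cring_axioms by (intro localization_at_prime.intro)
  have "generic \<notin> {Q' \<in> Spec R. ?Q \<subseteq> Q'}" using generic_subset[OF Q] ne by blast
  then have "{Q' \<in> Spec R. ?Q \<subseteq> Q'} \<subset> topspace (zariski R)"
    unfolding topspace_zariski[OF ring_axioms] using generic_Spec by blast
  from one_le_codim[OF irreducible_topspace this]
  have codim: "enat 1 \<le> codim (zariski R) {Q' \<in> Spec R. ?Q \<subseteq> Q'}" unfolding one_enat_def .
  have "enat 1 \<le> depth (localization R ?Q)" by (rule serre_S_depth[OF ring_axioms S2 Q _ codim]) simp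
  then have "1 \<le> depth (localization R ?Q)" unfolding one_enat_def .
  then have "\<exists>u \<in> carrier R - ?Q. u \<otimes> w = \<zero>"
    by (rule localization_at_prime.depth_ge_1_annihilator[OF loc _ w]) simp
  then show False by auto
qed

text \<open>Each zero divisor lies in an associated prime, and the generic prime is the only one.\<close>

lemma zero_divisor_generic:
  assumes s: "s \<in> carrier R" and w: "w \<in> carrier R" and "s \<otimes> w = \<zero>" and "w \<noteq> \<zero>"
  shows "s \<in> generic"
proof -
  obtain c where c: "c \<in> carrier R" "primeideal {r \<in> carrier R. r \<otimes> (c \<otimes> w) \<in> {\<zero>}} R"
    using noetherian_associated_prime[OF cring_axioms noetherian_ring_axioms zeroideal w] assms(4)
    by blast
  then have "{r \<in> carrier R. r \<otimes> (c \<otimes> w) = \<zero>} = generic"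
    by (intro annihilator_prime_eq_generic) (use w in \<open>auto simp: Spec_def\<close>)
  moreover have "s \<otimes> (c \<otimes> w) = c \<otimes> (s \<otimes> w)" using s w c(1) by (simp add: m_lcomm)
  ultimately show ?thesis using assms(3) c(1) s by auto
qed

text \<open>If no power of \<open>b\<close> vanishes, let the ascending chain of annihilators of powers stop at \<open>b\<^sup>k\<close>. Some
  nonzero multiple \<open>c b\<^sup>k\<close> is annihilated by the generic prime, in particular by \<open>b\<close>, and then
  \<open>c b\<^sup>k = 0\<close> because the chain has stopped.\<close>

lemma generic_nilpotent:
  assumes b: "b \<in> generic"
  shows "\<exists>k::nat. b [^] k = \<zero>"
proof (rule ccontr)
  assume nil: "\<nexists>k::nat. b [^] k = \<zero>"
  have bR: "b \<in> carrier R" using Spec_carr[OF generic_Spec b] .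
  let ?ann = "\<lambda>k::nat. {r \<in> carrier R. r \<otimes> b [^] k = \<zero>}"
  have ideals: "ideal (?ann k) R" for k
  proof (rule idealI_closed)
    fix r x assume *: "r \<in> carrier R" "x \<in> ?ann k"
    then show "r \<otimes> x \<in> ?ann k" using bR by (simp add: m_assoc)
    with * show "x \<otimes> r \<in> ?ann k" using m_comm[of x r] by simp
  qed (use bR in \<open>auto simp: l_distr\<close>)
  then have "\<exists>M\<in>range ?ann. \<forall>J\<in>range ?ann. M \<subseteq> J \<longrightarrow> J = M"
    by (intro exists_maximal_ideal_in) auto
  then obtain k where max: "\<And>l. ?ann k \<subseteq> ?ann l \<Longrightarrow> ?ann l = ?ann k" by auto
  obtain c where c: "c \<in> carrier R" "primeideal {r \<in> carrier R. r \<otimes> (c \<otimes> b [^] k) \<in> {\<zero>}} R"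
    using noetherian_associated_prime[OF cring_axioms noetherian_ring_axioms zeroideal, of "b [^] k"]
      nil bR by blast
  then have gen: "{r \<in> carrier R. r \<otimes> (c \<otimes> b [^] k) = \<zero>} = generic"
    by (intro annihilator_prime_eq_generic) (use bR in \<open>auto simp: Spec_def\<close>)
  then have "b \<otimes> (c \<otimes> b [^] k) = \<zero>" using b by auto
  then have "c \<in> ?ann (Suc k)" using bR c(1) by (simp add: m_ac)
  moreover have "?ann (Suc k) = ?ann k"
  proof (rule max)
    show "?ann k \<subseteq> ?ann (Suc k)"
    proof
      fix r assume "r \<in> ?ann k"
      then have r: "r \<in> carrier R" "r \<otimes> b [^] k = \<zero>" by auto
      have "r \<otimes> b [^] Suc k = (r \<otimes> b [^] k) \<otimes> b" using r(1) bR by (simp add: m_assoc)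
      then show "r \<in> ?ann (Suc k)" using r bR by simp
    qed
  qed
  ultimately have "c \<in> ?ann k" by (simp only:)
  then have "\<one> \<in> generic" unfolding gen[symmetric] using c(1) bR by simp
  then show False using primeideal.I_notcarr[OF generic_prime]
      ideal.one_imp_carrier[OF primeideal.axioms(1)[OF generic_prime]] by simp
qed

text \<open>A fraction \<open>a / s\<close> whose ideal of denominators defines a closed set of codimension at least two
  is an element of the ring. Otherwise some associated prime \<open>(s : c a)\<close> of \<open>s\<close> contains the ideal of
  denominators, so it has codimension at least two and therefore depth at least two; but depth two
  rules out that a prime multiplies \<open>c a\<close> into the multiples of \<open>s\<close> while \<open>c a\<close> is not locally such a
  multiple.\<close>

lemma divides_if_codim_2:
  assumes W: "2 \<le> codim (zariski R) W"
    and s: "s \<in> carrier R" "s \<notin> generic" and a: "a \<in> carrier R"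
    and colon: "\<And>Q. Q \<in> Spec R \<Longrightarrow> {r \<in> carrier R. \<exists>v\<in>carrier R. r \<otimes> a = s \<otimes> v} \<subseteq> Q \<Longrightarrow> Q \<in> W"
  shows "\<exists>f \<in> carrier R. a = s \<otimes> f"
proof (rule ccontr)
  assume no: "\<not> ?thesis"
  define I where "I = PIdl s"
  have I_iff: "x \<in> I \<longleftrightarrow> (\<exists>v\<in>carrier R. x = s \<otimes> v)" for x
    unfolding I_def cgenideal_def using s m_comm by auto
  have I: "ideal I R" unfolding I_def using cgenideal_ideal s by simp
  have "a \<notin> I" using no I_iff by simp
  then obtain c where c: "c \<in> carrier R" "primeideal {r \<in> carrier R. r \<otimes> (c \<otimes> a) \<in> I} R"
    using noetherian_associated_prime[OF cring_axioms noetherian_ring_axioms I a] by blast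
  let ?Q = "{r \<in> carrier R. r \<otimes> (c \<otimes> a) \<in> I}"
  have Q: "?Q \<in> Spec R" using c unfolding Spec_def by simp
  have loc: "localization_at_prime R ?Q"
    using c cring_axioms by (intro localization_at_prime.intro)
  have "{r \<in> carrier R. \<exists>v\<in>carrier R. r \<otimes> a = s \<otimes> v} \<subseteq> ?Q"
  proof
    fix r assume "r \<in> {r \<in> carrier R. \<exists>v\<in>carrier R. r \<otimes> a = s \<otimes> v}"
    then have r: "r \<in> carrier R" "r \<otimes> a \<in> I" unfolding I_iff by blast+
    then have "c \<otimes> (r \<otimes> a) \<in> I" using ideal.I_l_closed[OF I] c(1) by blast
    then show "r \<in> ?Q" using r(1) c(1) a by (simp add: m_lcomm)
  qed
  then have "{Q' \<in> Spec R. ?Q \<subseteq> Q'} \<subseteq> W" using colon by blast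
  from order_trans[OF W codim_antimono[OF this]]
  have codim: "enat 2 \<le> codim (zariski R) {Q' \<in> Spec R. ?Q \<subseteq> Q'}" unfolding numeral_eq_enat .
  have "enat 2 \<le> depth (localization R ?Q)" by (rule serre_S_depth[OF ring_axioms S2 Q _ codim]) simp
  then have "2 \<le> depth (localization R ?Q)" unfolding numeral_eq_enat .
  then have "\<exists>u \<in> carrier R - ?Q. \<exists>r \<in> carrier R. u \<otimes> (c \<otimes> a) = s \<otimes> r"
  proof (rule localization_at_prime.depth_ge_2_colon[OF loc])
    show "z = \<zero>" if "z \<in> carrier R" "s \<otimes> z = \<zero>" for z
      using zero_divisor_generic[OF s(1) that] s(2) by blast
    show "\<exists>v\<in>carrier R. q \<otimes> (c \<otimes> a) = s \<otimes> v" if "q \<in> ?Q" for q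
      using that I_iff[of "q \<otimes> (c \<otimes> a)"] by simp
  qed (use s c(1) a in simp_all)
  then obtain u where "u \<in> carrier R - ?Q" "u \<otimes> (c \<otimes> a) \<in> I" unfolding I_iff by blast
  then show False by simp
qed

end

lemma (in cring) primeideal_contract:
  assumes C: "subring C R" and Q: "primeideal Q R"
  shows "primeideal (Q \<inter> C) (R\<lparr>carrier := C\<rparr>)"
proof (rule primeidealI)
  interpret Q: primeideal Q R by fact
  show "ideal (Q \<inter> C) (R\<lparr>carrier := C\<rparr>)"
  proof (rule ideal_of_subringI[OF C])
    show "\<zero> \<in> Q \<inter> C"
      using subringE(2)[OF C] additive_subgroup.zero_closed[OF Q.is_additive_subgroup] by simp
    show "x \<oplus> y \<in> Q \<inter> C" if "x \<in> Q \<inter> C" "y \<in> Q \<inter> C" for x y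
      using that subringE(7)[OF C] additive_subgroup.a_closed[OF Q.is_additive_subgroup] by simp
    show "r \<otimes> x \<in> Q \<inter> C" if "r \<in> C" "x \<in> Q \<inter> C" for r x
      using that subringE(1,6)[OF C] Q.I_l_closed by auto
  qed auto
  show "cring (R\<lparr>carrier := C\<rparr>)"
    using subcring_iff[OF subringE(1)[OF C]] subcringI'[OF C] by simp
  have "\<one> \<notin> Q" using Q.I_notcarr Q.one_imp_carrier by auto
  then show "carrier (R\<lparr>carrier := C\<rparr>) \<noteq> Q \<inter> C" using subringE(3)[OF C] by auto
  show "a \<in> Q \<inter> C \<or> b \<in> Q \<inter> C"
    if "a \<in> carrier (R\<lparr>carrier := C\<rparr>)" "b \<in> carrier (R\<lparr>carrier := C\<rparr>)"
      "a \<otimes>\<^bsub>R\<lparr>carrier := C\<rparr>\<^esub> b \<in> Q \<inter> C" for a b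
    using that Q.I_prime subringE(1)[OF C] by auto
qed

section \<open>Normality in terms of equations\<close>

text \<open>For \<open>x = a / s\<close> and coefficients \<open>c\<^sub>i = b\<^sub>i / t\<close>, multiplying a monic equation for \<open>x\<close> by \<open>t s\<^sup>n\<close> gives
  an equation between elements of the base ring.\<close>

lemma (in ring_hom_cring) hom_homogenized_equation:
  fixes n :: nat
  assumes a: "a \<in> carrier R" and s: "s \<in> carrier R" and t: "t \<in> carrier R"
    and b: "\<And>i. i < n \<Longrightarrow> b i \<in> carrier R"
    and x: "x \<in> carrier S" "x \<otimes>\<^bsub>S\<^esub> h s = h a"
    and c: "\<And>i. i < n \<Longrightarrow> c i \<in> carrier S" "\<And>i. i < n \<Longrightarrow> c i \<otimes>\<^bsub>S\<^esub> h t = h (b i)"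
  shows "h (t \<otimes> a [^] n \<oplus> (\<Oplus>i\<in>{..<n}. b i \<otimes> (a [^] i \<otimes> s [^] (n - i)))) =
    (h t \<otimes>\<^bsub>S\<^esub> h s [^]\<^bsub>S\<^esub> n) \<otimes>\<^bsub>S\<^esub> (x [^]\<^bsub>S\<^esub> n \<oplus>\<^bsub>S\<^esub> (\<Oplus>\<^bsub>S\<^esub>i\<in>{..<n}. c i \<otimes>\<^bsub>S\<^esub> x [^]\<^bsub>S\<^esub> i))"
proof -
  let ?d = "h t \<otimes>\<^bsub>S\<^esub> h s [^]\<^bsub>S\<^esub> n"
  have hs: "h s \<in> carrier S" "h t \<in> carrier S" using s t by auto
  have pow: "h (a [^] i) = x [^]\<^bsub>S\<^esub> i \<otimes>\<^bsub>S\<^esub> h s [^]\<^bsub>S\<^esub> i" for i :: nat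
    using a s x(1) by (simp add: hom_pow x(2)[symmetric] S.nat_pow_distrib)
  have "h (t \<otimes> a [^] n) = ?d \<otimes>\<^bsub>S\<^esub> x [^]\<^bsub>S\<^esub> n"
    using t a pow[of n] hs x(1) by (simp add: S.m_ac)
  moreover have "h (b i \<otimes> (a [^] i \<otimes> s [^] (n - i))) = ?d \<otimes>\<^bsub>S\<^esub> (c i \<otimes>\<^bsub>S\<^esub> x [^]\<^bsub>S\<^esub> i)"
    if i: "i < n" for i
  proof -
    have "h (b i \<otimes> (a [^] i \<otimes> s [^] (n - i))) = h (b i) \<otimes>\<^bsub>S\<^esub> (h (a [^] i) \<otimes>\<^bsub>S\<^esub> h (s [^] (n - i)))"
      using a s b[OF i] by simp
    also have "\<dots> = (c i \<otimes>\<^bsub>S\<^esub> h t) \<otimes>\<^bsub>S\<^esub> ((x [^]\<^bsub>S\<^esub> i \<otimes>\<^bsub>S\<^esub> h s [^]\<^bsub>S\<^esub> i) \<otimes>\<^bsub>S\<^esub> h s [^]\<^bsub>S\<^esub> (n - i))"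
      unfolding pow c(2)[OF i, symmetric] hom_pow[OF s] ..
    also have "\<dots> = h t \<otimes>\<^bsub>S\<^esub> (h s [^]\<^bsub>S\<^esub> i \<otimes>\<^bsub>S\<^esub> h s [^]\<^bsub>S\<^esub> (n - i)) \<otimes>\<^bsub>S\<^esub> (c i \<otimes>\<^bsub>S\<^esub> x [^]\<^bsub>S\<^esub> i)"
      using hs x(1) c(1)[OF i] by (simp add: S.m_ac)
    also have "h s [^]\<^bsub>S\<^esub> i \<otimes>\<^bsub>S\<^esub> h s [^]\<^bsub>S\<^esub> (n - i) = h s [^]\<^bsub>S\<^esub> n"
      using hs i by (simp add: S.nat_pow_mult)
    finally show ?thesis .
  qed
  then have "h (\<Oplus>i\<in>{..<n}. b i \<otimes> (a [^] i \<otimes> s [^] (n - i))) =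
      ?d \<otimes>\<^bsub>S\<^esub> (\<Oplus>\<^bsub>S\<^esub>i\<in>{..<n}. c i \<otimes>\<^bsub>S\<^esub> x [^]\<^bsub>S\<^esub> i)"
    using a s b c(1) hs x(1)
    by (subst S.finsum_rdistr) (auto simp: hom_finsum Pi_def intro!: S.finsum_cong')
  ultimately show ?thesis
    using a s t b c(1) hs x(1) by (simp add: S.r_distr Pi_def R.finsum_closed S.finsum_closed)
qed

context localization_at_prime
begin

lemma common_denominator:
  fixes n :: nat
  assumes "\<And>i. i < n \<Longrightarrow> y i \<in> carrier L"
  obtains t b where "t \<in> denominators"
    and "\<And>i. i < n \<Longrightarrow> b i \<in> carrier R \<and> y i \<otimes>\<^bsub>L\<^esub> \<rho> t = \<rho> (b i)"
proof -
  have "\<exists>t \<in> denominators. \<forall>i<n. \<exists>b \<in> carrier R. y i \<otimes>\<^bsub>L\<^esub> \<rho> t = \<rho> b"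
    using assms
  proof (induction n)
    case 0
    then show ?case using one_denominator by auto
  next
    case (Suc n)
    then obtain t where t: "t \<in> denominators" "\<And>i. i < n \<Longrightarrow> \<exists>b \<in> carrier R. y i \<otimes>\<^bsub>L\<^esub> \<rho> t = \<rho> b"
      by (meson less_SucI)
    obtain f u where f: "f \<in> carrier R" "u \<in> denominators" "y n \<otimes>\<^bsub>L\<^esub> \<rho> u = \<rho> f"
      using fraction_cases Suc.prems by blast
    have tu: "t \<in> carrier R" "u \<in> carrier R" using t f by auto
    have "\<exists>b \<in> carrier R. y i \<otimes>\<^bsub>L\<^esub> \<rho> (t \<otimes> u) = \<rho> b" if i: "i < Suc n" for i
    proof (cases "i = n")
      case True
      have "y i \<otimes>\<^bsub>L\<^esub> \<rho> (t \<otimes> u) = \<rho> t \<otimes>\<^bsub>L\<^esub> (y n \<otimes>\<^bsub>L\<^esub> \<rho> u)"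
        using Suc.prems[OF i] True tu by (simp add: L.m_ac)
      also have "\<dots> = \<rho> (t \<otimes> f)" unfolding f(3) using f(1) tu by simp
      finally show ?thesis using f(1) tu by blast
    next
      case False
      then obtain b where b: "b \<in> carrier R" "y i \<otimes>\<^bsub>L\<^esub> \<rho> t = \<rho> b" using t(2)[of i] i by auto
      have "y i \<otimes>\<^bsub>L\<^esub> \<rho> (t \<otimes> u) = (y i \<otimes>\<^bsub>L\<^esub> \<rho> t) \<otimes>\<^bsub>L\<^esub> \<rho> u"
        using Suc.prems[OF i] tu by (simp add: L.m_ac)
      also have "\<dots> = \<rho> (b \<otimes> u)" unfolding b(2) using b(1) tu by simp
      finally show ?thesis using b(1) tu by blast
    qed
    then show ?case using denominators_mult[OF t(1) f(2)] by blast
  qed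
  then obtain t where t: "t \<in> denominators"
    and ex: "\<forall>i<n. \<exists>b \<in> carrier R. y i \<otimes>\<^bsub>L\<^esub> \<rho> t = \<rho> b"
    by (rule bexE)
  have "\<forall>i. \<exists>b. i < n \<longrightarrow> b \<in> carrier R \<and> y i \<otimes>\<^bsub>L\<^esub> \<rho> t = \<rho> b"
    using ex by blast
  from choice[OF this] show thesis using that[OF t] by blast
qed

lemma rho_inj:
  assumes "domain R" and "a \<in> carrier R" and "\<rho> a = \<zero>\<^bsub>L\<^esub>"
  shows "a = \<zero>"
proof -
  interpret domain R by fact
  obtain u where u: "u \<in> denominators" "u \<otimes> a = \<zero>" using rho_eq_zero_iff assms(2,3) by auto
  moreover have "\<zero> \<in> P" using additive_subgroup.zero_closed[OF is_additive_subgroup] .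
  ultimately show ?thesis using integral[OF u(2)] assms(2) by auto
qed

lemma domain_L:
  assumes R: "domain R"
  shows "domain L"
proof (rule domain.intro[OF cring_L], unfold_locales)
  interpret R: domain R by fact
  show "\<one>\<^bsub>L\<^esub> \<noteq> \<zero>\<^bsub>L\<^esub>" using rho_inj[OF R, of \<one>] by auto
  fix x y assume xy: "x \<otimes>\<^bsub>L\<^esub> y = \<zero>\<^bsub>L\<^esub>" "x \<in> carrier L" "y \<in> carrier L"
  obtain a s where a: "a \<in> carrier R" "s \<in> denominators" "x \<otimes>\<^bsub>L\<^esub> \<rho> s = \<rho> a"
    using fraction_cases[OF xy(2)] .
  obtain b t where b: "b \<in> carrier R" "t \<in> denominators" "y \<otimes>\<^bsub>L\<^esub> \<rho> t = \<rho> b"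
    using fraction_cases[OF xy(3)] .
  have st: "s \<in> carrier R" "t \<in> carrier R" using a b by auto
  have "\<rho> (a \<otimes> b) = (x \<otimes>\<^bsub>L\<^esub> \<rho> s) \<otimes>\<^bsub>L\<^esub> (y \<otimes>\<^bsub>L\<^esub> \<rho> t)" unfolding a(3) b(3) using a(1) b(1) by simp
  also have "\<dots> = (x \<otimes>\<^bsub>L\<^esub> y) \<otimes>\<^bsub>L\<^esub> (\<rho> s \<otimes>\<^bsub>L\<^esub> \<rho> t)" using xy(2,3) st by (simp add: L.m_ac)
  also have "\<dots> = \<zero>\<^bsub>L\<^esub>" unfolding xy(1) using st by simp
  finally have "a \<otimes> b = \<zero>" using rho_inj[OF R, of "a \<otimes> b"] a(1) b(1) by simp
  then have "a = \<zero> \<or> b = \<zero>" using R.integral a(1) b(1) by blast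
  then have "x \<otimes>\<^bsub>L\<^esub> \<rho> s = \<zero>\<^bsub>L\<^esub> \<otimes>\<^bsub>L\<^esub> \<rho> s \<or> y \<otimes>\<^bsub>L\<^esub> \<rho> t = \<zero>\<^bsub>L\<^esub> \<otimes>\<^bsub>L\<^esub> \<rho> t"
    using a(3) b(3) st by auto
  then show "x = \<zero>\<^bsub>L\<^esub> \<or> y = \<zero>\<^bsub>L\<^esub>"
    using cancel_rho[OF a(2) xy(2)] cancel_rho[OF b(2) xy(3)] by blast
qed

text \<open>Integral closedness of the localization of a domain, with all denominators cleared: a fraction
  \<open>a / s\<close> that satisfies an equation with coefficients \<open>b\<^sub>i / t\<close> in the localization belongs to the
  localization. The fractions here are those of \<open>R\<close> itself, so that the condition can be compared
  between different primes.\<close>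

definition integrally_closed_at :: bool where
  "integrally_closed_at \<longleftrightarrow>
    (\<forall>a \<in> carrier R. \<forall>s \<in> carrier R - {\<zero>}. \<forall>t \<in> denominators. \<forall>(n::nat) b.
      (\<forall>i<n. b i \<in> carrier R) \<longrightarrow>
      t \<otimes> a [^] n \<oplus> (\<Oplus>i\<in>{..<n}. b i \<otimes> (a [^] i \<otimes> s [^] (n - i))) = \<zero> \<longrightarrow>
      (\<exists>u \<in> denominators. \<exists>f \<in> carrier R. u \<otimes> a = s \<otimes> f))"

text \<open>The fraction field of the localization is also the fraction field of \<open>R\<close>: by the injective
  homomorphism \<open>\<phi>\<close>, which runs through the localization, each of its elements is a quotient of
  elements of \<open>R\<close>, and integral equations translate back and forth.\<close>

lemma normal_domain_localization_iff:
  assumes R: "domain R"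
  shows "normal_domain L \<longleftrightarrow> integrally_closed_at"
proof -
  interpret R: domain R by fact
  interpret D: domain L by (rule domain_L[OF R])
  interpret F: localization_at_prime L "{\<zero>\<^bsub>L\<^esub>}"
    using D.zeroprimeideal cring_L by (intro localization_at_prime.intro)
  have F_domain: "domain F.L" by (rule F.domain_L[OF D.domain_axioms])
  interpret F: domain F.L by (rule F_domain)
  define \<phi> where "\<phi> r = F.\<rho> (\<rho> r)" for r
  interpret \<phi>: ring_hom_cring R F.L \<phi>
    by (rule ring_hom_cringI[OF cring_axioms F.cring_L], rule ring_hom_memI) (auto simp: \<phi>_def)
  have \<phi>_inj: "a = \<zero>" if "a \<in> carrier R" "\<phi> a = \<zero>\<^bsub>F.L\<^esub>" for a
    using F.rho_inj[OF D.domain_axioms, of "\<rho> a"] rho_inj[OF R that(1)] that unfolding \<phi>_def by simp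
  have cancel: "x = y" if "x \<in> carrier F.L" "y \<in> carrier F.L" "s \<in> carrier R" "s \<noteq> \<zero>"
      "x \<otimes>\<^bsub>F.L\<^esub> \<phi> s = y \<otimes>\<^bsub>F.L\<^esub> \<phi> s" for x y s
    using F.m_rcancel[of "\<phi> s" x y] \<phi>_inj[of s] that by auto
  have den: "u \<in> carrier R" "u \<noteq> \<zero>" if "u \<in> denominators" for u
    using that additive_subgroup.zero_closed[OF is_additive_subgroup] by auto
  have lift: "F.\<rho> y \<otimes>\<^bsub>F.L\<^esub> \<phi> u = \<phi> f" if "y \<in> carrier L" "u \<in> carrier R" "y \<otimes>\<^bsub>L\<^esub> \<rho> u = \<rho> f" for y u f
    using that unfolding \<phi>_def by (simp flip: that(3))
  have norm: "normal_domain L \<longleftrightarrow>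
      (\<forall>x \<in> carrier F.L. integral_over F.L (F.\<rho> ` carrier L) x \<longrightarrow> x \<in> F.\<rho> ` carrier L)"
  proof -
    have "to_fraction_field L = F.\<rho>" by (rule ext) (simp add: to_fraction_field_def F.\<rho>_def)
    then show ?thesis unfolding normal_domain_def fraction_field_def using D.domain_axioms by simp
  qed
  show ?thesis
  proof
    assume N: "normal_domain L"
    show integrally_closed_at
      unfolding integrally_closed_at_def
    proof (intro ballI allI impI)
      fix a s t and n :: nat and b
      assume a: "a \<in> carrier R" and s: "s \<in> carrier R - {\<zero>}" and t: "t \<in> denominators"
        and b: "\<forall>i<n. b i \<in> carrier R"
        and eq: "t \<otimes> a [^] n \<oplus> (\<Oplus>i\<in>{..<n}. b i \<otimes> (a [^] i \<otimes> s [^] (n - i))) = \<zero>"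
      have "\<rho> s \<in> carrier L - {\<zero>\<^bsub>L\<^esub>}" using s rho_inj[OF R, of s] by auto
      then obtain x where x: "x \<in> carrier F.L" "x \<otimes>\<^bsub>F.L\<^esub> \<phi> s = \<phi> a"
        unfolding \<phi>_def using F.fraction_exists[of "\<rho> a" "\<rho> s"] a by auto
      have "\<forall>i. \<exists>y. i < n \<longrightarrow> y \<in> carrier L \<and> y \<otimes>\<^bsub>L\<^esub> \<rho> t = \<rho> (b i)"
        using fraction_exists[OF _ t] b by metis
      then obtain y where y: "\<And>i. i < n \<Longrightarrow> y i \<in> carrier L"
        "\<And>i. i < n \<Longrightarrow> y i \<otimes>\<^bsub>L\<^esub> \<rho> t = \<rho> (b i)" by metis
      let ?x = "x [^]\<^bsub>F.L\<^esub> n \<oplus>\<^bsub>F.L\<^esub> (\<Oplus>\<^bsub>F.L\<^esub>i\<in>{..<n}. F.\<rho> (y i) \<otimes>\<^bsub>F.L\<^esub> x [^]\<^bsub>F.L\<^esub> i)"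
      have x_carr: "?x \<in> carrier F.L"
        using x(1) y(1) by (auto intro!: F.L.finsum_closed)
      \<comment> \<open>The image of the given equation is the monic equation for \<open>x\<close> times the nonzero factor \<open>\<phi> g\<close>.\<close>
      define g where "g = t \<otimes> s [^] n"
      have "s [^] k \<noteq> \<zero>" for k :: nat
        by (induction k) (use s R.integral_iff in auto)
      then have g: "g \<in> carrier R" "g \<noteq> \<zero>"
        using s den[OF t] R.integral_iff[of t "s [^] n"] by (auto simp: g_def)
      have \<phi>_g: "\<phi> g = \<phi> t \<otimes>\<^bsub>F.L\<^esub> \<phi> s [^]\<^bsub>F.L\<^esub> n"
        using s den[OF t] by (simp add: \<phi>.hom_pow g_def)
      have "\<phi> g \<otimes>\<^bsub>F.L\<^esub> ?x = \<phi> \<zero>"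
        unfolding eq[symmetric] \<phi>_g
        by (rule \<phi>.hom_homogenized_equation[symmetric])
          (use a s den[OF t] b x y lift in auto)
      then have "\<phi> g \<otimes>\<^bsub>F.L\<^esub> ?x = \<zero>\<^bsub>F.L\<^esub>" unfolding \<phi>.hom_zero .
      then have "\<phi> g = \<zero>\<^bsub>F.L\<^esub> \<or> ?x = \<zero>\<^bsub>F.L\<^esub>"
        by (rule F.integral[OF _ \<phi>.hom_closed[OF g(1)] x_carr])
      then have "?x = \<zero>\<^bsub>F.L\<^esub>" using \<phi>_inj g by blast
      then have "integral_over F.L (F.\<rho> ` carrier L) x"
        unfolding integral_over_def using y(1) by (intro exI[of _ n] exI[of _ "\<lambda>i. F.\<rho> (y i)"]) auto
      then obtain z where z: "z \<in> carrier L" "x = F.\<rho> z" using N x(1) unfolding norm by auto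
      obtain f u where f: "f \<in> carrier R" "u \<in> denominators" "z \<otimes>\<^bsub>L\<^esub> \<rho> u = \<rho> f"
        using fraction_cases[OF z(1)] .
      have zu: "x \<otimes>\<^bsub>F.L\<^esub> \<phi> u = \<phi> f" unfolding z(2) using lift[OF z(1) _ f(3)] den[OF f(2)] by simp
      have "\<phi> (u \<otimes> a) = \<phi> u \<otimes>\<^bsub>F.L\<^esub> (x \<otimes>\<^bsub>F.L\<^esub> \<phi> s)"
        unfolding x(2) using a den[OF f(2)] by simp
      also have "\<dots> = \<phi> s \<otimes>\<^bsub>F.L\<^esub> (x \<otimes>\<^bsub>F.L\<^esub> \<phi> u)"
        using x(1) s den[OF f(2)] by (simp add: F.L.m_ac)
      also have "\<dots> = \<phi> (s \<otimes> f)" unfolding zu using s f(1) by simp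
      finally have "\<phi> (u \<otimes> a \<ominus> s \<otimes> f) = \<zero>\<^bsub>F.L\<^esub>"
        using a s f(1) den[OF f(2)] by (simp add: minus_eq F.L.r_neg)
      then have "u \<otimes> a = s \<otimes> f"
        using \<phi>_inj[of "u \<otimes> a \<ominus> s \<otimes> f"] a s f(1) den[OF f(2)] by simp
      then show "\<exists>u \<in> denominators. \<exists>f \<in> carrier R. u \<otimes> a = s \<otimes> f" using f by blast
    qed
  next
    assume closed: integrally_closed_at
    show "normal_domain L"
      unfolding norm
    proof (intro ballI impI)
      fix x assume x: "x \<in> carrier F.L" and "integral_over F.L (F.\<rho> ` carrier L) x"
      then obtain n :: nat and c where c: "\<forall>i<n. c i \<in> F.\<rho> ` carrier L" and
        eq: "x [^]\<^bsub>F.L\<^esub> n \<oplus>\<^bsub>F.L\<^esub> (\<Oplus>\<^bsub>F.L\<^esub>i\<in>{..<n}. c i \<otimes>\<^bsub>F.L\<^esub> x [^]\<^bsub>F.L\<^esub> i) = \<zero>\<^bsub>F.L\<^esub>"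
        unfolding integral_over_def by (elim exE conjE)
      have "\<forall>i. \<exists>y. i < n \<longrightarrow> y \<in> carrier L \<and> c i = F.\<rho> y" using c by blast
      then obtain y where y: "\<And>i. i < n \<Longrightarrow> y i \<in> carrier L" "\<And>i. i < n \<Longrightarrow> c i = F.\<rho> (y i)"
        by metis
      obtain t b where t: "t \<in> denominators"
        and b: "\<And>i. i < n \<Longrightarrow> b i \<in> carrier R \<and> y i \<otimes>\<^bsub>L\<^esub> \<rho> t = \<rho> (b i)"
        using common_denominator[of n y] y(1) by blast
      obtain a s where a: "a \<in> carrier R" and s: "s \<in> carrier R" "s \<noteq> \<zero>"
        and as: "x \<otimes>\<^bsub>F.L\<^esub> \<phi> s = \<phi> a"
      proof -
        obtain p q where p: "p \<in> carrier L" "q \<in> carrier L - {\<zero>\<^bsub>L\<^esub>}" "x \<otimes>\<^bsub>F.L\<^esub> F.\<rho> q = F.\<rho> p"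
          using F.fraction_cases[OF x] .
        \<comment> \<open>Numerator and denominator of \<open>x\<close> are elements of the localization; a common denominator moves both to \<open>R\<close>.\<close>
        have pq: "(if i = 0 then p else q) \<in> carrier L" for i :: nat using p by simp
        obtain w d where w: "w \<in> denominators" and d: "\<And>i. i < (2::nat) \<Longrightarrow>
            d i \<in> carrier R \<and> (if i = 0 then p else q) \<otimes>\<^bsub>L\<^esub> \<rho> w = \<rho> (d i)"
          by (rule common_denominator[of 2 "\<lambda>i. if i = 0 then p else q", OF pq]) (rule that)
        have d0: "d 0 \<in> carrier R" "p \<otimes>\<^bsub>L\<^esub> \<rho> w = \<rho> (d 0)"
          and d1: "d 1 \<in> carrier R" "q \<otimes>\<^bsub>L\<^esub> \<rho> w = \<rho> (d 1)"
          using d[of 0] d[of 1] by auto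
        have "\<rho> w \<noteq> \<zero>\<^bsub>L\<^esub>" using rho_inj[OF R] den[OF w] by blast
        then have "\<rho> (d 1) \<noteq> \<zero>\<^bsub>L\<^esub>"
          unfolding d1(2)[symmetric] using D.integral_iff[of q "\<rho> w"] p(2) den[OF w] by auto
        then have "d 1 \<noteq> \<zero>" by auto
        have "x \<otimes>\<^bsub>F.L\<^esub> \<phi> (d 1) = (x \<otimes>\<^bsub>F.L\<^esub> F.\<rho> q) \<otimes>\<^bsub>F.L\<^esub> \<phi> w"
          using lift[OF _ _ d1(2)] p(2) den[OF w] x by (simp add: F.L.m_assoc \<phi>_def)
        also have "\<dots> = \<phi> (d 0)"
          unfolding p(3) using lift[OF p(1) _ d0(2)] den[OF w] by simp
        finally show thesis using that[OF d0(1) d1(1) \<open>d 1 \<noteq> \<zero>\<close>] by simp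
      qed
      let ?e = "t \<otimes> a [^] n \<oplus> (\<Oplus>i\<in>{..<n}. b i \<otimes> (a [^] i \<otimes> s [^] (n - i)))"
      have e_carr: "?e \<in> carrier R"
        using a s den[OF t] b by (auto intro!: finsum_closed)
      have "\<phi> ?e = (\<phi> t \<otimes>\<^bsub>F.L\<^esub> \<phi> s [^]\<^bsub>F.L\<^esub> n) \<otimes>\<^bsub>F.L\<^esub>
          (x [^]\<^bsub>F.L\<^esub> n \<oplus>\<^bsub>F.L\<^esub> (\<Oplus>\<^bsub>F.L\<^esub>i\<in>{..<n}. c i \<otimes>\<^bsub>F.L\<^esub> x [^]\<^bsub>F.L\<^esub> i))"
        by (rule \<phi>.hom_homogenized_equation) (use a s den[OF t] b x as y lift in auto)
      also have "\<dots> = \<zero>\<^bsub>F.L\<^esub>" unfolding eq using den[OF t] s by simp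
      finally have "?e = \<zero>" using \<phi>_inj e_carr by blast
      then obtain u f where u: "u \<in> denominators" and f: "f \<in> carrier R" and uf: "u \<otimes> a = s \<otimes> f"
        using closed[unfolded integrally_closed_at_def, rule_format, of a s t n b] a s t b by auto
      obtain z where z: "z \<in> carrier L" "z \<otimes>\<^bsub>L\<^esub> \<rho> u = \<rho> f" using fraction_exists[OF f u] .
      have "(x \<otimes>\<^bsub>F.L\<^esub> \<phi> u) \<otimes>\<^bsub>F.L\<^esub> \<phi> s = \<phi> u \<otimes>\<^bsub>F.L\<^esub> (x \<otimes>\<^bsub>F.L\<^esub> \<phi> s)"
        using x s den[OF u] by (simp add: F.L.m_ac)
      also have "\<dots> = \<phi> (u \<otimes> a)" unfolding as using a den[OF u] by simp
      also have "\<dots> = \<phi> f \<otimes>\<^bsub>F.L\<^esub> \<phi> s" unfolding uf using s f by (simp add: F.L.m_comm)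
      finally have xu: "(x \<otimes>\<^bsub>F.L\<^esub> \<phi> u) \<otimes>\<^bsub>F.L\<^esub> \<phi> s = \<phi> f \<otimes>\<^bsub>F.L\<^esub> \<phi> s" .
      have "x \<otimes>\<^bsub>F.L\<^esub> \<phi> u = \<phi> f"
        by (rule cancel[OF _ _ s xu]) (use x f den[OF u] in simp_all)
      also have "\<dots> = F.\<rho> z \<otimes>\<^bsub>F.L\<^esub> \<phi> u" using lift[OF z(1) _ z(2)] den[OF u] by simp
      finally have "x = F.\<rho> z"
        by (rule cancel[OF x F.\<rho>.hom_closed[OF z(1)] den[OF u]])
      then show "x \<in> F.\<rho> ` carrier L" using z(1) by blast
    qed
  qed
qed

end

text \<open>If \<open>a / s\<close> is integral over the localization, with common denominator \<open>t\<close> of the coefficients,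
  then \<open>t a / s\<close> is integral over the ring itself: multiply the equation by \<open>t\<^sup>n\<^sup>-\<^sup>1\<close>.\<close>

lemma (in cring) make_monic:
  fixes n :: nat
  assumes a: "a \<in> carrier R" and s: "s \<in> carrier R" and t: "t \<in> carrier R"
    and b: "\<And>i. i < n \<Longrightarrow> b i \<in> carrier R" and n: "n \<noteq> 0"
  shows "\<one> \<otimes> (t \<otimes> a) [^] n \<oplus>
      (\<Oplus>i\<in>{..<n}. (b i \<otimes> t [^] (n - 1 - i)) \<otimes> ((t \<otimes> a) [^] i \<otimes> s [^] (n - i))) =
    t [^] (n - 1) \<otimes> (t \<otimes> a [^] n \<oplus> (\<Oplus>i\<in>{..<n}. b i \<otimes> (a [^] i \<otimes> s [^] (n - i))))"
proof -
  have "(b i \<otimes> t [^] (n - 1 - i)) \<otimes> ((t \<otimes> a) [^] i \<otimes> s [^] (n - i)) =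
      t [^] (n - 1) \<otimes> (b i \<otimes> (a [^] i \<otimes> s [^] (n - i)))" if i: "i < n" for i
  proof -
    have "(b i \<otimes> t [^] (n - 1 - i)) \<otimes> ((t \<otimes> a) [^] i \<otimes> s [^] (n - i)) =
        (t [^] (n - 1 - i) \<otimes> t [^] i) \<otimes> (b i \<otimes> (a [^] i \<otimes> s [^] (n - i)))"
      using a s t b[OF i] by (simp add: nat_pow_distrib m_ac)
    then show ?thesis using t i by (simp add: nat_pow_mult)
  qed
  then have "(\<Oplus>i\<in>{..<n}. (b i \<otimes> t [^] (n - 1 - i)) \<otimes> ((t \<otimes> a) [^] i \<otimes> s [^] (n - i))) =
      t [^] (n - 1) \<otimes> (\<Oplus>i\<in>{..<n}. b i \<otimes> (a [^] i \<otimes> s [^] (n - i)))"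
    using a s t b by (subst finsum_rdistr) (auto intro!: finsum_cong')
  moreover have "\<one> \<otimes> (t \<otimes> a) [^] n = t [^] (n - 1) \<otimes> (t \<otimes> a [^] n)"
  proof -
    have "t [^] n = t [^] (n - 1) \<otimes> t" using n by (cases n) auto
    then show ?thesis using a t by (simp add: nat_pow_distrib m_assoc)
  qed
  moreover have "(\<Oplus>i\<in>{..<n}. b i \<otimes> (a [^] i \<otimes> s [^] (n - i))) \<in> carrier R"
    using a s b by (auto intro!: finsum_closed)
  ultimately show ?thesis using a t by (simp add: r_distr)
qed

section \<open>Subrings closed under division, and invariant rings\<close>

text \<open>Normality extends over a closed set whose preimage in the spectrum of \<open>R\<close> has codimension at
  least two, for every subring that contains the quotients in \<open>R\<close> of its elements. The codimension
  condition enters twice: it forces \<open>U\<close> to contain the point below the generic point of \<open>R\<close>, and it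
  lets an integral fraction, once it is known to be regular on \<open>U\<close>, extend to an element of \<open>R\<close>.\<close>

theorem (in irreducible_S2_ring) normal_subring:
  assumes C: "subring C R"
    and quotients: "\<And>a s f. a \<in> C \<Longrightarrow> s \<in> C \<Longrightarrow> s \<notin> generic \<Longrightarrow> f \<in> carrier R \<Longrightarrow> a = s \<otimes> f \<Longrightarrow> f \<in> C"
    and U: "openin (zariski (R\<lparr>carrier := C\<rparr>)) U" and normal: "normal_on (R\<lparr>carrier := C\<rparr>) U"
    and codim: "2 \<le> codim (zariski R) {Q \<in> Spec R. Q \<inter> C \<notin> U}"
  shows "normal_on (R\<lparr>carrier := C\<rparr>) (Spec (R\<lparr>carrier := C\<rparr>))"
proof -
  let ?B = "R\<lparr>carrier := C\<rparr>"
  interpret B: cring ?B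
    using subcring_iff[OF subringE(1)[OF C]] subcringI'[OF C] by simp
  have CR: "c \<in> carrier R" if "c \<in> C" for c using subringE(1)[OF C] that by auto
  define N where "N = generic \<inter> C"
  have N: "primeideal N ?B" unfolding N_def by (rule primeideal_contract[OF C generic_prime])
  then have N_Spec: "N \<in> Spec ?B" unfolding Spec_def by simp
  \<comment> \<open>Open sets are stable under generization, so otherwise the preimage of the complement of \<open>U\<close> would be everything.\<close>
  have "N \<in> U"
  proof (rule ccontr)
    assume "N \<notin> U"
    then have "Q \<inter> C \<notin> U" if "Q \<in> Spec R" for Q
      using zariski_open_generization[OF U _ N_Spec, of "Q \<inter> C"] generic_subset[OF that]
      unfolding N_def by blast
    then have "{Q \<in> Spec R. Q \<inter> C \<notin> U} = topspace (zariski R)"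
      unfolding topspace_zariski[OF ring_axioms] by auto
    then show False using codim codim_topspace_eq_0[OF irreducible_topspace] by simp
  qed
  \<comment> \<open>The subring embeds in its local ring at \<open>N\<close>, because elements outside the generic prime are not zero divisors.\<close>
  have B_domain: "domain ?B"
  proof -
    interpret L: localization_at_prime ?B N
      using N B.cring_axioms by (intro localization_at_prime.intro)
    have "domain L.L" using normal \<open>N \<in> U\<close> unfolding normal_on_def normal_domain_def by blast
    then interpret D: domain L.L .
    have inj: "a = \<zero>" if a: "a \<in> C" "L.\<rho> a = \<zero>\<^bsub>L.L\<^esub>" for a
    proof -
      obtain u where "u \<in> C - N" "u \<otimes> a = \<zero>" using L.rho_eq_zero_iff[of a] a by auto
      then show ?thesis using zero_divisor_generic[of u a] CR a(1) unfolding N_def by auto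
    qed
    show ?thesis
    proof (rule domain.intro[OF B.cring_axioms], rule domain_axioms.intro)
      show "\<one>\<^bsub>?B\<^esub> \<noteq> \<zero>\<^bsub>?B\<^esub>" using L.one_denominator L.zero_closed by (metis DiffD2)
      fix a b assume ab: "a \<otimes>\<^bsub>?B\<^esub> b = \<zero>\<^bsub>?B\<^esub>" "a \<in> carrier ?B" "b \<in> carrier ?B"
      have "L.\<rho> a \<otimes>\<^bsub>L.L\<^esub> L.\<rho> b = \<zero>\<^bsub>L.L\<^esub>"
        unfolding L.\<rho>.hom_mult[OF ab(2,3), symmetric] ab(1) by (rule L.\<rho>.hom_zero)
      then have "L.\<rho> a = \<zero>\<^bsub>L.L\<^esub> \<or> L.\<rho> b = \<zero>\<^bsub>L.L\<^esub>"
        by (rule D.integral[OF _ L.\<rho>.hom_closed[OF ab(2)] L.\<rho>.hom_closed[OF ab(3)]])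
      then show "a = \<zero>\<^bsub>?B\<^esub> \<or> b = \<zero>\<^bsub>?B\<^esub>"
        using inj[of a] inj[of b] ab(2,3) by auto
    qed
  qed
  then interpret B: domain ?B .
  \<comment> \<open>Members of the generic prime are nilpotent, and the subring is a domain.\<close>
  have s_not_generic: "s \<notin> generic" if "s \<in> C" "s \<noteq> \<zero>" for s
  proof
    assume "s \<in> generic"
    then obtain k :: nat where k: "s [^] k = \<zero>" using generic_nilpotent by auto
    have "s [^] k \<in> C \<and> s [^] k \<noteq> \<zero>" for k :: nat
    proof (induction k)
      case 0
      then show ?case using B.one_not_zero subringE(3)[OF C] by simp
    next
      case (Suc k)
      then show ?case using B.integral[of "s [^] k" s] that subringE(6)[OF C] by auto
    qed
    then show False using k by blast
  qed
  show ?thesis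
    unfolding normal_on_def
  proof
    fix P assume "P \<in> Spec ?B"
    then have P: "primeideal P ?B" unfolding Spec_def by simp
    interpret L: localization_at_prime ?B P
      using P B.cring_axioms by (intro localization_at_prime.intro)
    have "L.integrally_closed_at"
      unfolding L.integrally_closed_at_def
    proof (intro ballI allI impI)
      fix a s t b and n :: nat
      assume a: "a \<in> carrier ?B" and s: "s \<in> carrier ?B - {\<zero>\<^bsub>?B\<^esub>}" and t: "t \<in> carrier ?B - P"
        and b: "\<forall>i<n. b i \<in> carrier ?B"
        and eq: "t \<otimes>\<^bsub>?B\<^esub> a [^]\<^bsub>?B\<^esub> n \<oplus>\<^bsub>?B\<^esub>
          (\<Oplus>\<^bsub>?B\<^esub>i\<in>{..<n}. b i \<otimes>\<^bsub>?B\<^esub> (a [^]\<^bsub>?B\<^esub> i \<otimes>\<^bsub>?B\<^esub> s [^]\<^bsub>?B\<^esub> (n - i))) = \<zero>\<^bsub>?B\<^esub>"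
      \<comment> \<open>The fraction \<open>a' / s\<close> is integral over the subring itself, hence over its localizations at all points of \<open>U\<close>.\<close>
      define a' where "a' = t \<otimes>\<^bsub>?B\<^esub> a"
      define b' where "b' i = b i \<otimes>\<^bsub>?B\<^esub> t [^]\<^bsub>?B\<^esub> (n - 1 - i)" for i
      have tB: "t \<in> carrier ?B" and sB: "s \<in> carrier ?B" using t s by auto
      have a': "a' \<in> carrier ?B" unfolding a'_def by (rule B.m_closed[OF tB a])
      have b': "\<forall>i<n. b' i \<in> carrier ?B" unfolding b'_def using b tB B.m_closed B.nat_pow_closed by blast
      have "n \<noteq> 0"
      proof
        assume "n = 0"
        then have "t = \<zero>\<^bsub>?B\<^esub>" using eq tB B.r_one[OF tB] B.r_zero[OF tB] by simp
        then show False
          using t additive_subgroup.zero_closed[OF ideal.axioms(1)[OF primeideal.axioms(1)[OF P]]] by simp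
      qed
      have monic: "\<one>\<^bsub>?B\<^esub> \<otimes>\<^bsub>?B\<^esub> a' [^]\<^bsub>?B\<^esub> n \<oplus>\<^bsub>?B\<^esub>
          (\<Oplus>\<^bsub>?B\<^esub>i\<in>{..<n}. b' i \<otimes>\<^bsub>?B\<^esub> (a' [^]\<^bsub>?B\<^esub> i \<otimes>\<^bsub>?B\<^esub> s [^]\<^bsub>?B\<^esub> (n - i))) = \<zero>\<^bsub>?B\<^esub>"
        unfolding a'_def b'_def
        by (rule trans[OF B.make_monic[OF a sB tB _ \<open>n \<noteq> 0\<close>]], use b in blast, unfold eq,
            rule B.r_null[OF B.nat_pow_closed[OF tB]])
      have local: "\<exists>u \<in> C - Q. \<exists>f \<in> C. u \<otimes> a' = s \<otimes> f" if Q: "Q \<in> U" for Q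
      proof -
        have "Q \<in> Spec ?B"
          using openin_subset[OF U] Q topspace_zariski[OF B.ring_axioms] by auto
        then interpret Q: localization_at_prime ?B Q
          using B.cring_axioms unfolding Spec_def by (intro localization_at_prime.intro) auto
        have "Q.integrally_closed_at"
          using Q.normal_domain_localization_iff[OF B_domain] normal Q unfolding normal_on_def by blast
        from this[unfolded Q.integrally_closed_at_def, rule_format, OF a' s Q.one_denominator _ monic] b'
        show ?thesis by auto
      qed
      \<comment> \<open>Each point of \<open>U\<close> avoids some denominator of \<open>a' / s\<close>, so the denominators vanish only over the complement of \<open>U\<close>.\<close>
      have "\<exists>f \<in> carrier R. a' = s \<otimes> f"
      proof (rule divides_if_codim_2[OF codim])
        show "s \<in> carrier R" "s \<notin> generic" "a' \<in> carrier R"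
          using s a' CR s_not_generic by auto
      next
        fix Q assume Q: "Q \<in> Spec R" "{r \<in> carrier R. \<exists>v\<in>carrier R. r \<otimes> a' = s \<otimes> v} \<subseteq> Q"
        have "Q \<inter> C \<notin> U"
        proof
          assume "Q \<inter> C \<in> U"
          from local[OF this] obtain u f where "u \<in> C" "u \<notin> Q" "f \<in> C" "u \<otimes> a' = s \<otimes> f" by auto
          then show False using Q(2) CR by blast
        qed
        then show "Q \<in> {Q \<in> Spec R. Q \<inter> C \<notin> U}" using Q(1) by simp
      qed
      then obtain f where f: "f \<in> carrier R" "a' = s \<otimes> f" by auto
      then have "f \<in> C" using quotients[of a' s f] a' s s_not_generic by auto
      then show "\<exists>u \<in> carrier ?B - P. \<exists>f \<in> carrier ?B. u \<otimes>\<^bsub>?B\<^esub> a = s \<otimes>\<^bsub>?B\<^esub> f"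
        using t f(2) unfolding a'_def by auto
    qed
    then show "normal_domain L.L" using L.normal_domain_localization_iff[OF B_domain] by simp
  qed
qed

text \<open>If \<open>a = s f\<close> with invariant \<open>a\<close> and \<open>s\<close>, then \<open>s f = s (g f)\<close> for each \<open>g\<close> in the group, and \<open>f\<close> is
  invariant when \<open>s\<close> is not a zero divisor.\<close>

theorem corollary7p2:
  fixes K :: "'k ring" and A :: "('k, 'a) module"
    and G :: "'g monoid" and KG :: "('g \<Rightarrow> 'k) set" and \<sigma> :: "'g \<Rightarrow> 'a \<Rightarrow> 'a"
    and U Z :: "'a set set"
  assumes "algebraically_closed K" and "char_zero K"
    and "finite_type_algebra K A" and "irreducible_in (zariski A) (Spec A)"
    and "reductive_group K G KG" and "algebraic_action K G KG A \<sigma>"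
    and "openin (zariski (invariant_ring G A \<sigma>)) U"
    and "normal_on (invariant_ring G A \<sigma>) U"
    and "Z = Spec (invariant_ring G A \<sigma>) - U"
    and "codim (zariski (invariant_ring G A \<sigma>)) Z \<ge> 2"
    and "codim (zariski A) {P \<in> Spec A. invariant_quotient_map G A \<sigma> P \<in> Z} \<ge> 2"
    and "serre_S 2 A"
  shows "normal_on (invariant_ring G A \<sigma>) (Spec (invariant_ring G A \<sigma>))"
proof -
  have "field K" using assms(1) unfolding algebraically_closed_def by simp
  have "cring A" using assms(3) unfolding finite_type_algebra_def algebra_def by simp
  then interpret irreducible_S2_ring A
    using noetherian_finite_type_algebra[OF \<open>field K\<close> assms(3)] assms(4,12)
    by (intro irreducible_S2_ring.intro irreducible_S2_ring_axioms.intro)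
  define C where "C = {f \<in> carrier A. \<forall>g \<in> carrier G. \<sigma> g f = f}"
  have B: "invariant_ring G A \<sigma> = A\<lparr>carrier := C\<rparr>" unfolding invariant_ring_def C_def ..
  have hom: "ring_hom_cring A A (\<sigma> g)" if "g \<in> carrier G" for g
    using assms(6) that cring_axioms unfolding algebraic_action_def algebra_hom_def
    by (intro ring_hom_cringI) auto
  have C: "subring C A"
  proof (rule subringI)
    fix h assume "h \<in> C"
    then show "\<ominus>\<^bsub>A\<^esub> h \<in> C"
      using ring_hom_cring.hom_a_inv[OF hom] unfolding C_def by auto
    fix h' assume "h' \<in> C"
    then show "h \<otimes>\<^bsub>A\<^esub> h' \<in> C" "h \<oplus>\<^bsub>A\<^esub> h' \<in> C"
      using \<open>h \<in> C\<close> ring_hom_mult[OF ring_hom_cring.homh[OF hom]]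
        ring_hom_add[OF ring_hom_cring.homh[OF hom]]
      unfolding C_def by auto
  qed (use ring_hom_one[OF ring_hom_cring.homh[OF hom]] in \<open>auto simp: C_def\<close>)
  show ?thesis
    unfolding B
  proof (rule normal_subring[OF C])
    fix a s f
    assume a: "a \<in> C" and s: "s \<in> C" "s \<notin> generic" and f: "f \<in> carrier A" "a = s \<otimes>\<^bsub>A\<^esub> f"
    have sA: "s \<in> carrier A" using s unfolding C_def by simp
    have "\<sigma> g f = f" if g: "g \<in> carrier G" for g
    proof -
      interpret g: ring_hom_cring A A "\<sigma> g" by (rule hom[OF g])
      have "s \<otimes>\<^bsub>A\<^esub> \<sigma> g f = \<sigma> g a" using s sA f g unfolding C_def by simp
      also have "\<dots> = s \<otimes>\<^bsub>A\<^esub> f" using a f g unfolding C_def by simp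
      finally show ?thesis
        by (rule regular_mult_cancel[OF g.hom_closed[OF f(1)] f(1) sA])
          (use zero_divisor_generic[OF sA] s(2) in blast)
    qed
    then show "f \<in> C" unfolding C_def using f(1) by simp
  next
    show "openin (zariski (A\<lparr>carrier := C\<rparr>)) U" "normal_on (A\<lparr>carrier := C\<rparr>) U"
      using assms(7,8) unfolding B by auto
    have "{P \<in> Spec A. invariant_quotient_map G A \<sigma> P \<in> Z} = {Q \<in> Spec A. Q \<inter> C \<notin> U}"
      using primeideal_contract[OF C Spec_primeideal]
      unfolding invariant_quotient_map_def assms(9) B by (auto simp: Spec_def)
    then show "2 \<le> codim (zariski A) {Q \<in> Spec A. Q \<inter> C \<notin> U}" using assms(11) by simp
  qed
qed

end
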